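(* Let $N\geq 2$ be an integer, and let $u_1,\dots,u_{N-1}$ be bounded vector fields from a convex domain $\Omega\subset\mathbb{R}^d$ into $\mathbb{R}^d$. (1) If the $(N-1)$-tuple $(u_1,\dots,u_{N-1})$ is jointly $N$-monotone, then there exists an $N$-sub-antisymmetric Hamiltonian $H$ (a real-valued function on $\Omega^N$) that is zero on the diagonal of $\Omega^N$ (i.e. $H(x,x,\dots,x)=0$ for all $x\in\Omega$), concave in the first variable, and jointly convex in the other $(N-1)$ variables, such that $$(u_1(x),\dots,u_{N-1}(x))=\nabla_{2,\dots,N}H(x,x,\dots,x)\quad\text{for a.e. }x\in\Omega .\qquad( * )$$ Moreover, $H$ is $N$-antisymmetric in the following sense: $$H(x_1,x_2,\dots,x_N)+H_{2,\dots,N}(x_1,x_2,\dots,x_N)=0\quad\text{for all }(x_1,\dots,x_N)\in\Omega^N,$$ where $H_{2,\dots,N}$ is the concavification of the function $K(\mathbf{x})=\sum_{i=1}^{N-1}H(\sigma^i(\mathbf{x}))$ with respect to the last $(N-1)$ variables. Furthermore, there exists a continuous $N$-antisymmetric Hamiltonian $\bar H$ on $\Omega^N$ such that $$L_{\bar H}(x,u_1(x),u_2(x),\dots,u_{N-1}(x))=\sum_{i=1}^{N-1}\langle u_i(x),x\rangle\quad\text{for all }x\in\Omega .$$ (2) Conversely, if $(u_1,\dots,u_{N-1})$ satisfies $( * )$ for some $N$-sub-antisymmetric Hamiltonian $H$ that is zero on the diagonal of $\Omega^N$, concave in the first variable, and jointly convex in the other $(N-1)$ variables, then the $(N-1)$-tuple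 $(u_1,\dots,u_{N-1})$ is jointly $N$-monotone on $\Omega$.
   Context: "A.e." refers to Lebesgue measure. Jointly $N$-monotone: the $(N-1)$-tuple $(u_1,\dots,u_{N-1})$ of vector fields from $\Omega$ into $\mathbb{R}^d$ is jointly $N$-monotone (on $\Omega$) if for every cycle $x_1,\dots,x_{2N-1}$ of points in $\Omega$ such that $x_{N+i}=x_i$ for $1\le i\le N-1$, one has $\sum_{i=1}^N\sum_{\ell=1}^{N-1}\langle u_\ell(x_i),x_i-x_{\ell+i}\rangle\ge 0$. The map $\sigma$ is the cyclic permutation $\sigma(x_1,x_2,\dots,x_{N-1},x_N)=(x_2,x_3,\dots,x_N,x_1)$, with iterates $\sigma^i$. A function $H$ on $\Omega^N$ is $N$-sub-antisymmetric if $\sum_{i=0}^{N-1}H(\sigma^i(x_1,\dots,x_N))\le 0$ on $\Omega^N$. A continuous $N$-antisymmetric Hamiltonian on $\Omega^N$ is a function $H\in C(\Omega^N)$ with $\sum_{i=0}^{N-1}H(\sigma^i(x_1,\dots,x_N))=0$ on $\Omega^N$. $\nabla_{2,\dots,N}H(x,x,\dots,x)$ denotes the gradient of $(y_1,\dots,y_{N-1})\mapsto H(x,y_1,\dots,y_{N-1})$ at $(y_1,\dots,y_{N-1})=(x,\dots,x)$. The concavification of a function $K$ on $\Omega^N$ with respect to the last $(N-1)$ variables is $$(x_1,\dots,x_N)\mapsto\sup\Big\{\sum_{i=1}^n\lambda_iK(x_1,x_2^i,\dots,x_N^i):\ n\in\mathbb{N},\ \lambda_i\ge0,\ \sum_{i=1}^n\lambda_i=1,\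 x_j^i\in\Omega,\ \sum_{i=1}^n\lambda_i(x_2^i,\dots,x_N^i)=(x_2,\dots,x_N)\Big\}.$$ For a function $H$ on $\Omega^N$, $x\in\Omega$ and $p_1,\dots,p_{N-1}\in\mathbb{R}^d$, $$L_H(x,p_1,\dots,p_{N-1})=\sup\Big\{\sum_{i=1}^{N-1}\langle p_i,y_i\rangle-H(x,y_1,\dots,y_{N-1}):\ y_i\in\Omega\Big\}.$$
   Formalization: Part (2) fails if ( * ) holds only a.e. (fields can be altered at a point). Proved instead: if ( * ) holds at every x in Ω, the tuple is jointly N-monotone; if ( * ) holds a.e., some jointly N-monotone tuple on Ω equals it wherever ( * ) holds. *)

theory Defs
  imports "HOL-Analysis.Analysis"
begin

text \<open>
  A point \<open>(x\<^sub>1, \<dots>, x\<^sub>m)\<close> of \<open>S\<^sup>m\<close> is an extensional function on \<open>{1..m}\<close>. Extensionality makes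
  this encoding bijective, and the topology that \<open>tuples m S\<close> inherits from the product topology on
  \<^typ>\<open>nat \<Rightarrow> 'a\<close> is the one of \<open>S\<^sup>m\<close>. A function on \<open>S\<^sup>m\<close> is a total function on
  \<^typ>\<open>nat \<Rightarrow> 'a\<close> whose values outside \<open>tuples m S\<close> are never used.
\<close>

definition tuples :: "nat \<Rightarrow> 'a set \<Rightarrow> (nat \<Rightarrow> 'a) set" where
  "tuples m S = PiE {1..m} (\<lambda>_. S)"

definition diag :: "nat \<Rightarrow> 'a \<Rightarrow> nat \<Rightarrow> 'a" where
  "diag m x = (\<lambda>i\<in>{1..m}. x)"

text \<open>\<open>prepend N x y\<close> is the \<open>N\<close>-tuple \<open>(x, y\<^sub>1, \<dots>, y\<^bsub>N-1\<^esub>)\<close>.\<close>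

definition prepend :: "nat \<Rightarrow> 'a \<Rightarrow> (nat \<Rightarrow> 'a) \<Rightarrow> nat \<Rightarrow> 'a" where
  "prepend N x y = (\<lambda>i\<in>{1..N}. if i = 1 then x else y (i - 1))"

definition cyc :: "nat \<Rightarrow> (nat \<Rightarrow> 'a) \<Rightarrow> nat \<Rightarrow> 'a" where
  "cyc N x = (\<lambda>i\<in>{1..N}. if i = N then x 1 else x (i + 1))"

text \<open>The fields \<open>u\<^sub>1, \<dots>, u\<^bsub>N-1\<^esub>\<close> are \<open>u 1, \<dots>, u (N - 1)\<close>.\<close>

definition jointly_monotone ::
  "nat \<Rightarrow> 'a::euclidean_space set \<Rightarrow> (nat \<Rightarrow> 'a \<Rightarrow> 'a) \<Rightarrow> bool" where
  "jointly_monotone N \<Omega> u \<longleftrightarrow>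
     (\<forall>x. (\<forall>i\<in>{1..2 * N - 1}. x i \<in> \<Omega>) \<and> (\<forall>i\<in>{1..N - 1}. x (N + i) = x i) \<longrightarrow>
        (\<Sum>i=1..N. \<Sum>l=1..N - 1. u l (x i) \<bullet> (x i - x (l + i))) \<ge> 0)"

definition sub_antisymmetric :: "nat \<Rightarrow> 'a set \<Rightarrow> ((nat \<Rightarrow> 'a) \<Rightarrow> real) \<Rightarrow> bool" where
  "sub_antisymmetric N \<Omega> H \<longleftrightarrow> (\<forall>x\<in>tuples N \<Omega>. (\<Sum>i=0..N - 1. H ((cyc N ^^ i) x)) \<le> 0)"

definition antisymmetric :: "nat \<Rightarrow> 'a set \<Rightarrow> ((nat \<Rightarrow> 'a) \<Rightarrow> real) \<Rightarrow> bool" where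
  "antisymmetric N \<Omega> H \<longleftrightarrow> (\<forall>x\<in>tuples N \<Omega>. (\<Sum>i=0..N - 1. H ((cyc N ^^ i) x)) = 0)"

definition zero_on_diagonal :: "nat \<Rightarrow> 'a set \<Rightarrow> ((nat \<Rightarrow> 'a) \<Rightarrow> real) \<Rightarrow> bool" where
  "zero_on_diagonal N \<Omega> H \<longleftrightarrow> (\<forall>x\<in>\<Omega>. H (diag N x) = 0)"

definition concave_in_first ::
  "nat \<Rightarrow> 'a::euclidean_space set \<Rightarrow> ((nat \<Rightarrow> 'a) \<Rightarrow> real) \<Rightarrow> bool" where
  "concave_in_first N \<Omega> H \<longleftrightarrow>
     (\<forall>y\<in>tuples (N - 1) \<Omega>. concave_on \<Omega> (\<lambda>x. H (prepend N x y)))"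

text \<open>
  Functions \<^typ>\<open>nat \<Rightarrow> 'a\<close> are not an instance of \<^class>\<open>real_vector\<close>, so \<^const>\<open>convex_on\<close>
  is unfolded here, with componentwise convex combinations.
\<close>

definition convex_in_others ::
  "nat \<Rightarrow> 'a::euclidean_space set \<Rightarrow> ((nat \<Rightarrow> 'a) \<Rightarrow> real) \<Rightarrow> bool" where
  "convex_in_others N \<Omega> H \<longleftrightarrow>
     (\<forall>x\<in>\<Omega>. \<forall>y\<in>tuples (N - 1) \<Omega>. \<forall>z\<in>tuples (N - 1) \<Omega>. \<forall>s\<ge>0. \<forall>t\<ge>0. s + t = 1 \<longrightarrow>
        H (prepend N x (\<lambda>i\<in>{1..N - 1}. s *\<^sub>R y i + t *\<^sub>R z i))
          \<le> s * H (prepend N x y) + t * H (prepend N x z))"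

text \<open>
  Frechet gradient on \<open>S\<^sup>m\<close>, for open \<open>S\<close>: the difference quotient of \<^const>\<open>has_derivative\<close> for the
  linear map \<open>h \<mapsto> \<langle>g\<^sub>1, h\<^sub>1\<rangle> + \<dots> + \<langle>g\<^sub>m, h\<^sub>m\<rangle>\<close>, with the Euclidean norm of \<open>z - y\<close> written as an
  \<^const>\<open>L2_set\<close>.
\<close>

definition has_tuple_gradient ::
  "nat \<Rightarrow> 'a::euclidean_space set \<Rightarrow> ((nat \<Rightarrow> 'a) \<Rightarrow> real) \<Rightarrow> (nat \<Rightarrow> 'a) \<Rightarrow> (nat \<Rightarrow> 'a) \<Rightarrow> bool"
  where
  "has_tuple_gradient m S F g y \<longleftrightarrow>
     ((\<lambda>z. (F z - F y - (\<Sum>i=1..m. g i \<bullet> (z i - y i)))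
             / L2_set (\<lambda>i. norm (z i - y i)) {1..m}) \<longlongrightarrow> 0)
       (at y within tuples m S)"

text \<open>\<open>(u\<^sub>1(x), \<dots>, u\<^bsub>N-1\<^esub>(x)) = \<nabla>\<^bsub>2,\<dots>,N\<^esub> H(x, x, \<dots>, x)\<close>, including the existence of the gradient.\<close>

definition diagonal_gradient_at ::
  "nat \<Rightarrow> 'a::euclidean_space set \<Rightarrow> ((nat \<Rightarrow> 'a) \<Rightarrow> real) \<Rightarrow> (nat \<Rightarrow> 'a \<Rightarrow> 'a) \<Rightarrow> 'a \<Rightarrow> bool"
  where
  "diagonal_gradient_at N \<Omega> H u x \<longleftrightarrow>
     has_tuple_gradient (N - 1) \<Omega> (\<lambda>y. H (prepend N x y)) (\<lambda>l. u l x) (diag (N - 1) x)"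

text \<open>
  Suprema are taken in \<^typ>\<open>ereal\<close>: they may be infinite for general arguments.
  The \<open>n\<close> competitors \<open>(x\<^sub>1, x\<^sub>2\<^sup>k, \<dots>, x\<^sub>N\<^sup>k)\<close> are the full tuples \<open>z k\<close> with \<open>z k 1 = x 1\<close>.
\<close>

definition concavification ::
  "nat \<Rightarrow> 'a::euclidean_space set \<Rightarrow> ((nat \<Rightarrow> 'a) \<Rightarrow> real) \<Rightarrow> (nat \<Rightarrow> 'a) \<Rightarrow> ereal" where
  "concavification N \<Omega> K x =
     Sup {ereal (\<Sum>k=1..n. c k * K (z k)) | (n::nat) (c::nat \<Rightarrow> real) (z::nat \<Rightarrow> nat \<Rightarrow> 'a).
            (\<forall>k\<in>{1..n}. c k \<ge> 0) \<and> (\<Sum>k=1..n. c k) = 1 \<and>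
            (\<forall>k\<in>{1..n}. z k \<in> tuples N \<Omega> \<and> z k 1 = x 1) \<and>
            (\<forall>j\<in>{2..N}. (\<Sum>k=1..n. c k *\<^sub>R z k j) = x j)}"

definition legendre ::
  "nat \<Rightarrow> 'a::euclidean_space set \<Rightarrow> ((nat \<Rightarrow> 'a) \<Rightarrow> real) \<Rightarrow> 'a \<Rightarrow> (nat \<Rightarrow> 'a) \<Rightarrow> ereal" where
  "legendre N \<Omega> H x p =
     (SUP y\<in>tuples (N - 1) \<Omega>. ereal ((\<Sum>i=1..N - 1. p i \<bullet> y i) - H (prepend N x y)))"

end

theory Submission
  imports Defs
begin

text \<open>
  Everything is expressed through the gap functional
  \<open>f w = \<Sum>\<^sub>l \<langle>u\<^sub>l(w\<^sub>1), w\<^bsub>l+1\<^esub> - w\<^sub>1\<rangle>\<close> (\<open>field_gap\<close>). The cycle sum in the definition of joint monotonicity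
  is minus the sum of \<open>f\<close> over all rotations of the cycle, so the fields are jointly monotone iff \<open>f\<close>
  is sub-antisymmetric (\<open>jointly_monotone_iff_sub_antisymmetric\<close>). The gap functional is affine in the
  last variables and zero on the diagonal; what it lacks is concavity in the first variable.

  The Hamiltonian \<open>H \<ge> f\<close> comes from an averaging iteration (\<open>exists_antisymmetric_majorant\<close>). Let \<open>H\<close> be
  sub-antisymmetric and convex in the last variables, let \<open>K\<close> be the sum of its nontrivial rotations,
  and \<open>C\<close> the concavification of \<open>K\<close>. Then \<open>K \<le> - H\<close>, and as \<open>- H\<close> is concave in the last variables,
  \<open>K \<le> C \<le> - H\<close>. The function \<open>((N - 1) H - C) / N\<close> is therefore at least \<open>H\<close>; it is again convex in the
  last variables, and it is again sub-antisymmetric because \<open>C \<ge> K\<close>. Iterating from \<open>f\<close> gives an increasing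
  sequence, bounded because of sub-antisymmetry, and its limit satisfies \<open>C = - H\<close>. Concavity in the
  first variable then needs no extra work: in every nontrivial rotation the first variable is one of
  the convex ones, so \<open>K\<close>, hence \<open>C = - H\<close>, is convex in it.

  For the gradient, \<open>f \<le> H\<close> with equality on the diagonal makes the fields a subgradient. In the other
  direction \<open>H\<close> is at most \<open>f\<close> minus the sum of all rotations of \<open>f\<close>. That sum would vanish if the fields
  were constant, so it is \<open>o(|y - x|)\<close> wherever all of them are continuous
  (\<open>diagonal_gradient_at_isCont\<close>). Jointly monotone fields are continuous almost everywhere
  (\<open>jointly_monotone_AE_isCont\<close>): a cycle with one entry \<open>y\<close> and the others at or near \<open>x\<close>
  (\<open>two_point_cycle\<close>) shows that their sum \<open>S\<close> is a monotone field, and that each single field is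
  continuous wherever \<open>S\<close> is. For \<open>S\<close> itself, monotone functions of one variable have countably many
  jumps, and Fubini's theorem transports this to almost every point
  (\<open>monotone_field_AE_isCont\<close>).

  Subtracting from \<open>H\<close> its average over all rotations gives an antisymmetric function that still
  dominates \<open>f\<close>, which is the claim on the Legendre transform. It is continuous since a locally bounded
  function that is convex or concave in each coordinate is locally Lipschitz.

  Conversely, convexity turns the gradient into the inequality \<open>f \<le> H\<close>, and summing over rotations gives
  joint monotonicity. Where only almost every point has a gradient, limits of the fields along the
  points that have one satisfy the same inequality, since \<open>H\<close> is continuous in its first variable.
\<close>

section \<open>Tuples and cyclic rotation\<close>

lemma tuples_D: "x \<in> tuples m S \<Longrightarrow> i \<in> {1..m} \<Longrightarrow> x i \<in> S"
  by (auto simp: tuples_def PiE_iff)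

lemma tuples_restrictI: "(\<And>i. i \<in> {1..m} \<Longrightarrow> f i \<in> S) \<Longrightarrow> (\<lambda>i\<in>{1..m}. f i) \<in> tuples m S"
  by (auto simp: tuples_def)

lemma tuples_eqI:
  assumes "x \<in> tuples m S" "y \<in> tuples m T" "\<And>i. i \<in> {1..m} \<Longrightarrow> x i = y i"
  shows "x = y"
  by (rule extensionalityI[of _ "{1..m}"]) (use assms in \<open>auto simp: tuples_def PiE_iff\<close>)

lemma tuples_fun_upd: "x \<in> tuples m S \<Longrightarrow> i \<in> {1..m} \<Longrightarrow> a \<in> S \<Longrightarrow> x(i := a) \<in> tuples m S"
  by (auto simp: tuples_def PiE_iff extensional_def)

lemma diag_in_tuples: "a \<in> S \<Longrightarrow> diag m a \<in> tuples m S"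
  unfolding diag_def by (rule tuples_restrictI)

lemma prepend_in_tuples:
  assumes "a \<in> S" "y \<in> tuples (N - 1) S"
  shows "prepend N a y \<in> tuples N S"
  unfolding prepend_def
proof (rule tuples_restrictI)
  fix i assume "i \<in> {1..N}"
  then have "i = 1 \<or> i - 1 \<in> {1..N - 1}" by auto
  then show "(if i = 1 then a else y (i - 1)) \<in> S"
    using assms(1) tuples_D[OF assms(2), of "i - 1"] by auto
qed

lemma prepend_first_rest:
  assumes "N \<ge> 1" "w \<in> tuples N S"
  shows "prepend N (w 1) (\<lambda>i\<in>{1..N - 1}. w (i + 1)) = w"
proof
  fix i show "prepend N (w 1) (\<lambda>i\<in>{1..N - 1}. w (i + 1)) i = w i"
  proof (cases "i \<in> {1..N}")
    case True
    then show ?thesis by (cases "i = 1") (auto simp: prepend_def)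
  next
    case False
    then have "w i = undefined" using assms(2) unfolding tuples_def by (rule PiE_arb[rotated])
    then show ?thesis using False unfolding prepend_def by (simp only: restrict_apply if_False)
  qed
qed

lemma rest_in_tuples:
  "w \<in> tuples N S \<Longrightarrow> (\<lambda>i\<in>{1..N - 1}. w (i + 1)) \<in> tuples (N - 1) S"
  by (rule tuples_restrictI) (auto simp: tuples_def PiE_iff)

lemma prepend_diag: "prepend N a (diag (N - 1) a) = diag N a"
  by (auto simp: prepend_def diag_def restrict_def fun_eq_iff)

lemma cyc_in_tuples: "x \<in> tuples N S \<Longrightarrow> cyc N x \<in> tuples N S"
  unfolding cyc_def by (rule tuples_restrictI) (auto simp: tuples_def PiE_iff)

lemma cyc_pow_in_tuples: "x \<in> tuples N S \<Longrightarrow> (cyc N ^^ i) x \<in> tuples N S"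
  by (induction i) (auto intro: cyc_in_tuples)

lemma cyc_pow_eq:
  assumes "N \<ge> 1" "x \<in> tuples N S"
  shows "(cyc N ^^ i) x = (\<lambda>j\<in>{1..N}. x ((j + i - 1) mod N + 1))"
proof (induction i)
  case 0
  show ?case
  proof
    fix j
    show "(cyc N ^^ 0) x j = (\<lambda>j\<in>{1..N}. x ((j + 0 - 1) mod N + 1)) j"
    proof (cases "j \<in> {1..N}")
      case True
      then have "(j + 0 - 1) mod N + 1 = j" by auto
      with True show ?thesis by simp
    next
      case False
      then have "x j = undefined" using assms(2) unfolding tuples_def by (rule PiE_arb[rotated])
      with False show ?thesis by (simp only: restrict_apply if_False funpow_0)
    qed
  qed
next
  case (Suc i)
  have "(N + Suc i - 1) mod N = i mod N" by simp
  then show ?case unfolding funpow.simps comp_def Suc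
    by (auto simp: cyc_def fun_eq_iff)
qed

lemma cyc_pow_nth:
  assumes "x \<in> tuples N S" "j \<in> {1..N}"
  shows "(cyc N ^^ i) x j = x ((j + i - 1) mod N + 1)"
  using cyc_pow_eq[of N x S i] assms by auto

lemma cyc_diag: "(cyc N ^^ i) (diag N a) = diag N a"
  by (induction i) (auto simp: cyc_def diag_def fun_eq_iff)

lemma cyc_pow_period:
  assumes "x \<in> tuples N S" shows "(cyc N ^^ N) x = x"
proof (rule tuples_eqI[OF cyc_pow_in_tuples[OF assms] assms])
  fix j assume j: "j \<in> {1..N}"
  then have "(j + N - 1) mod N = ((j - 1) + N) mod N" by (intro arg_cong2[of _ _ _ _ "(mod)"]) auto
  also have "\<dots> = j - 1" unfolding mod_add_self2 using j by auto
  finally have "(j + N - 1) mod N + 1 = j" using j by auto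
  then show "(cyc N ^^ N) x j = x j" using cyc_pow_nth[OF assms j] by simp
qed

definition orbit_sum :: "nat \<Rightarrow> ((nat \<Rightarrow> 'a) \<Rightarrow> real) \<Rightarrow> (nat \<Rightarrow> 'a) \<Rightarrow> real" where
  "orbit_sum N H x = (\<Sum>i=0..N - 1. H ((cyc N ^^ i) x))"

text \<open>The identity rotation is left out: the concavification of this sum is to become \<open>- H\<close>.\<close>

abbreviation (input) rotated_sum :: "nat \<Rightarrow> ((nat \<Rightarrow> 'a) \<Rightarrow> real) \<Rightarrow> (nat \<Rightarrow> 'a) \<Rightarrow> real" where
  "rotated_sum N H \<equiv> (\<lambda>x. \<Sum>i=1..N - 1. H ((cyc N ^^ i) x))"

lemma orbit_sum_split: "orbit_sum N H x = H x + rotated_sum N H x"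
  unfolding orbit_sum_def by (subst sum.atLeast_Suc_atMost) auto

lemma orbit_sum_cyc:
  assumes "N \<ge> 1" "x \<in> tuples N S"
  shows "orbit_sum N H (cyc N x) = orbit_sum N H x"
proof -
  have e: "{0..N - 1} = {..<N}" using assms by auto
  have "orbit_sum N H (cyc N x) = (\<Sum>i<N. H ((cyc N ^^ Suc i) x))"
    unfolding orbit_sum_def e by (simp add: funpow_swap1)
  also have "\<dots> = (\<Sum>i<Suc N. H ((cyc N ^^ i) x)) - H x"
    by (subst sum.lessThan_Suc_shift) simp
  also have "\<dots> = (\<Sum>i<N. H ((cyc N ^^ i) x))"
    using cyc_pow_period[OF assms(2)] by simp
  finally show ?thesis unfolding orbit_sum_def e .
qed

lemma orbit_sum_cyc_pow:
  assumes "N \<ge> 1" "x \<in> tuples N S"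
  shows "orbit_sum N H ((cyc N ^^ i) x) = orbit_sum N H x"
  by (induction i) (use orbit_sum_cyc[OF assms(1) cyc_pow_in_tuples[OF assms(2)]] in auto)

section \<open>Convexity on tuples\<close>

text \<open>
  Convex combinations are taken on whole tuples, so that they commute with rotation. Convexity in the
  last variables then means convexity along pairs of tuples with the same first entry, and concavity
  in the first variable means concavity along pairs that differ in the first entry only.
\<close>

definition mix :: "nat \<Rightarrow> real \<Rightarrow> (nat \<Rightarrow> 'a::real_vector) \<Rightarrow> real \<Rightarrow> (nat \<Rightarrow> 'a) \<Rightarrow> nat \<Rightarrow> 'a" where
  "mix N s x t y = (\<lambda>i\<in>{1..N}. s *\<^sub>R x i + t *\<^sub>R y i)"

lemma mix_in_tuples:
  assumes "convex S" "x \<in> tuples N S" "y \<in> tuples N S" "s \<ge> 0" "t \<ge> 0" "s + t = 1"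
  shows "mix N s x t y \<in> tuples N S"
  unfolding mix_def using assms
  by (intro tuples_restrictI) (auto intro!: convexD tuples_D[OF assms(2)] tuples_D[OF assms(3)])

lemma cyc_mix: "cyc N (mix N s x t y) = mix N s (cyc N x) t (cyc N y)"
  by (cases "N = 0") (auto simp: cyc_def mix_def fun_eq_iff)

lemma cyc_pow_mix: "(cyc N ^^ i) (mix N s x t y) = mix N s ((cyc N ^^ i) x) t ((cyc N ^^ i) y)"
  by (induction i) (auto simp: cyc_mix)

lemma convex_in_othersD:
  assumes "convex_in_others N \<Omega> H" "N \<ge> 1" "x \<in> tuples N \<Omega>" "y \<in> tuples N \<Omega>" "x 1 = y 1"
    and st: "s \<ge> 0" "t \<ge> 0" "s + t = 1"
  shows "H (mix N s x t y) \<le> s * H x + t * H y"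
proof -
  let ?x = "\<lambda>i\<in>{1..N - 1}. x (i + 1)" and ?y = "\<lambda>i\<in>{1..N - 1}. y (i + 1)"
  have a: "s *\<^sub>R y (Suc 0) + t *\<^sub>R y (Suc 0) = y (Suc 0)" using st by (simp flip: scaleR_left_distrib)
  have "prepend N (x 1) (\<lambda>i\<in>{1..N - 1}. s *\<^sub>R ?x i + t *\<^sub>R ?y i) = mix N s x t y"
    using assms(2,5) a unfolding prepend_def mix_def
    by (auto simp: fun_eq_iff)
  moreover have "x 1 \<in> \<Omega>" using assms(2,3) by (auto dest: tuples_D)
  ultimately show ?thesis
    using assms(1)[unfolded convex_in_others_def, rule_format, of "x 1" ?x ?y s t] st
      rest_in_tuples[OF assms(3)] rest_in_tuples[OF assms(4)]
      prepend_first_rest[OF assms(2,3)] prepend_first_rest[OF assms(2,4)] assms(5)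
    by simp
qed

lemma convex_in_othersI:
  assumes "N \<ge> 1"
    and H: "\<And>x y s t. x \<in> tuples N \<Omega> \<Longrightarrow> y \<in> tuples N \<Omega> \<Longrightarrow> x 1 = y 1 \<Longrightarrow> s \<ge> 0 \<Longrightarrow> t \<ge> 0 \<Longrightarrow>
      s + t = 1 \<Longrightarrow> H (mix N s x t y) \<le> s * H x + t * H y"
  shows "convex_in_others N \<Omega> H"
  unfolding convex_in_others_def
proof (intro ballI allI impI)
  fix x y z s t assume x: "x \<in> \<Omega>" and y: "y \<in> tuples (N - 1) \<Omega>" and z: "z \<in> tuples (N - 1) \<Omega>"
    and st: "(0::real) \<le> s" "(0::real) \<le> t" "s + t = 1"
  have a: "x = s *\<^sub>R x + t *\<^sub>R x" using st by (simp flip: scaleR_left_distrib)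
  have "prepend N x (\<lambda>i\<in>{1..N - 1}. s *\<^sub>R y i + t *\<^sub>R z i)
      = mix N s (prepend N x y) t (prepend N x z)"
    using a by (auto simp: prepend_def mix_def fun_eq_iff)
  moreover have "prepend N x y 1 = prepend N x z 1" using assms(1) by (simp add: prepend_def)
  ultimately show "H (prepend N x (\<lambda>i\<in>{1..N - 1}. s *\<^sub>R y i + t *\<^sub>R z i))
        \<le> s * H (prepend N x y) + t * H (prepend N x z)"
    using H[OF prepend_in_tuples[OF x y] prepend_in_tuples[OF x z] _ st] by simp
qed

text \<open>
  A nontrivial rotation moves the first variable to one of the last positions, and its own first entry
  is an entry on which \<open>x\<close> and \<open>y\<close> agree. So every summand is convex here.
\<close>

lemma rotated_sum_convex_in_first:
  assumes "convex_in_others N \<Omega> H" "x \<in> tuples N \<Omega>" "y \<in> tuples N \<Omega>"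
    and xy: "\<And>j. j \<in> {2..N} \<Longrightarrow> x j = y j"
    and st: "s \<ge> 0" "t \<ge> 0" "s + t = 1"
  shows "rotated_sum N H (mix N s x t y) \<le> s * rotated_sum N H x + t * rotated_sum N H y"
proof -
  have "H ((cyc N ^^ i) (mix N s x t y)) \<le> s * H ((cyc N ^^ i) x) + t * H ((cyc N ^^ i) y)"
    if i: "i \<in> {1..N - 1}" for i
  proof -
    have "(1 + i - 1) mod N + 1 = i + 1" using i by auto
    then have "(cyc N ^^ i) x 1 = (cyc N ^^ i) y 1"
      using i xy[of "i + 1"] cyc_pow_nth[OF assms(2), of 1 i] cyc_pow_nth[OF assms(3), of 1 i] by auto
    then show ?thesis unfolding cyc_pow_mix
      using i convex_in_othersD[OF assms(1) _ cyc_pow_in_tuples[OF assms(2)] cyc_pow_in_tuples[OF assms(3)] _ st]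
      by auto
  qed
  then have "rotated_sum N H (mix N s x t y)
      \<le> (\<Sum>i=1..N - 1. s * H ((cyc N ^^ i) x) + t * H ((cyc N ^^ i) y))"
    by (rule sum_mono)
  then show ?thesis by (simp add: sum.distrib sum_distrib_left)
qed

lemma concave_in_firstI:
  assumes "N \<ge> 1" "convex \<Omega>"
    and H: "\<And>x y s t. x \<in> tuples N \<Omega> \<Longrightarrow> y \<in> tuples N \<Omega> \<Longrightarrow> (\<And>j. j \<in> {2..N} \<Longrightarrow> x j = y j) \<Longrightarrow>
      s \<ge> 0 \<Longrightarrow> t \<ge> 0 \<Longrightarrow> s + t = 1 \<Longrightarrow> s * H x + t * H y \<le> H (mix N s x t y)"
  shows "concave_in_first N \<Omega> H"
  unfolding concave_in_first_def concave_on_def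
proof (intro ballI convex_onI assms(2))
  fix y x x' t assume y: "y \<in> tuples (N - 1) \<Omega>" and x: "x \<in> \<Omega>" "x' \<in> \<Omega>" and t: "(0::real) < t" "t < 1"
  have "(1 - t) *\<^sub>R y j + t *\<^sub>R y j = y j" for j by (simp flip: scaleR_left_distrib)
  then have "prepend N ((1 - t) *\<^sub>R x + t *\<^sub>R x') y = mix N (1 - t) (prepend N x y) t (prepend N x' y)"
    by (auto simp: prepend_def mix_def fun_eq_iff)
  moreover have "prepend N x y j = prepend N x' y j" if "j \<in> {2..N}" for j
    using that by (auto simp: prepend_def)
  ultimately show "- H (prepend N ((1 - t) *\<^sub>R x + t *\<^sub>R x') y)
      \<le> (1 - t) * - H (prepend N x y) + t * - H (prepend N x' y)"
    using H[OF prepend_in_tuples[OF x(1) y] prepend_in_tuples[OF x(2) y], of "1 - t" t] t by simp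
qed

text \<open>
  Induction on the number of points, grouping all but one of them into a single convex combination. The
  membership part of the conclusion is needed to apply binary convexity to the group.
\<close>

lemma convex_in_others_jensen:
  assumes "finite I" "I \<noteq> {}" "convex \<Omega>" "convex_in_others N \<Omega> H" "N \<ge> 1"
    and "\<And>k. k \<in> I \<Longrightarrow> c k \<ge> 0" "(\<Sum>k\<in>I. c k) = 1"
    and "\<And>k. k \<in> I \<Longrightarrow> z k \<in> tuples N \<Omega>" "\<And>k. k \<in> I \<Longrightarrow> z k 1 = a"
  shows "(\<lambda>j\<in>{1..N}. \<Sum>k\<in>I. c k *\<^sub>R z k j) \<in> tuples N \<Omega> \<and>
    H (\<lambda>j\<in>{1..N}. \<Sum>k\<in>I. c k *\<^sub>R z k j) \<le> (\<Sum>k\<in>I. c k * H (z k))"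
  using assms(1,2,6-9)
proof (induction I arbitrary: c rule: finite_ne_induct)
  case (singleton k)
  have "(\<lambda>j\<in>{1..N}. z k j) = z k"
    using singleton by (auto simp: tuples_def PiE_iff extensional_def fun_eq_iff)
  then show ?case using singleton by simp
next
  case (insert k I)
  define t where "t = (\<Sum>i\<in>I. c i)"
  have t: "t \<ge> 0" "c k \<ge> 0" "c k + t = 1" "finite I" "k \<notin> I"
    using insert by (auto simp: t_def intro: sum_nonneg)
  show ?case
  proof (cases "t = 0")
    case True
    then have "c i = 0" if "i \<in> I" for i
      using that insert.prems(1) t(4) unfolding t_def by (subst (asm) sum_nonneg_eq_0_iff) auto
    moreover have "(\<lambda>j\<in>{1..N}. z k j) = z k"
      using insert by (auto simp: tuples_def PiE_iff extensional_def fun_eq_iff)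
    ultimately show ?thesis using t True insert.prems(3)[of k] by (simp add: sum.insert)
  next
    case False
    let ?w = "\<lambda>j\<in>{1..N}. \<Sum>i\<in>I. (c i / t) *\<^sub>R z i j"
    have IH: "?w \<in> tuples N \<Omega> \<and> H ?w \<le> (\<Sum>i\<in>I. (c i / t) * H (z i))"
    proof (rule insert.IH)
      show "(\<Sum>i\<in>I. c i / t) = 1" using False by (simp add: t_def flip: sum_divide_distrib)
    qed (use insert.prems t in auto)
    have "?w 1 = (\<Sum>i\<in>I. c i / t) *\<^sub>R a"
      using insert.prems(4) assms(5) by (simp add: scaleR_sum_left)
    also have "\<dots> = z k 1"
      using False insert.prems(4)[of k] by (simp add: t_def flip: sum_divide_distrib)
    finally have one: "z k 1 = ?w 1" by simp
    have e: "(\<lambda>j\<in>{1..N}. \<Sum>i\<in>insert k I. c i *\<^sub>R z i j) = mix N (c k) (z k) t ?w"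
      using t False by (auto simp: mix_def fun_eq_iff scaleR_sum_right)
    have "H (mix N (c k) (z k) t ?w) \<le> c k * H (z k) + t * H ?w"
      using convex_in_othersD[OF assms(4,5), of "z k" ?w "c k" t] one IH t insert.prems(3)[of k]
      by simp
    also have "\<dots> \<le> c k * H (z k) + t * (\<Sum>i\<in>I. (c i / t) * H (z i))"
      using IH t by (intro add_left_mono mult_left_mono) auto
    also have "\<dots> = (\<Sum>i\<in>insert k I. c i * H (z i))"
      using t False by (simp add: sum_distrib_left)
    finally show ?thesis
      unfolding e using mix_in_tuples[OF assms(3) insert.prems(3)[of k], of ?w "c k" t] IH t by auto
  qed
qed

section \<open>Concavification in the last variables\<close>

text \<open>
  The competitors of the concavification as a set of reals: for the functions that occur below it is
  bounded above, so real suprema can be used in place of extended ones.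
\<close>

definition mixture_values ::
  "nat \<Rightarrow> 'a::euclidean_space set \<Rightarrow> ((nat \<Rightarrow> 'a) \<Rightarrow> real) \<Rightarrow> (nat \<Rightarrow> 'a) \<Rightarrow> real set" where
  "mixture_values N \<Omega> K x =
     {(\<Sum>k=1..n. c k * K (z k)) | (n::nat) (c::nat \<Rightarrow> real) (z::nat \<Rightarrow> nat \<Rightarrow> 'a).
            (\<forall>k\<in>{1..n}. c k \<ge> 0) \<and> (\<Sum>k=1..n. c k) = 1 \<and>
            (\<forall>k\<in>{1..n}. z k \<in> tuples N \<Omega> \<and> z k 1 = x 1) \<and>
            (\<forall>j\<in>{2..N}. (\<Sum>k=1..n. c k *\<^sub>R z k j) = x j)}"

definition concave_hull ::
  "nat \<Rightarrow> 'a::euclidean_space set \<Rightarrow> ((nat \<Rightarrow> 'a) \<Rightarrow> real) \<Rightarrow> (nat \<Rightarrow> 'a) \<Rightarrow> real" where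
  "concave_hull N \<Omega> K x = Sup (mixture_values N \<Omega> K x)"

lemma concavification_eq_Sup: "concavification N \<Omega> K x = (SUP v\<in>mixture_values N \<Omega> K x. ereal v)"
  unfolding concavification_def mixture_values_def by (rule arg_cong[of _ _ Sup]) blast

lemma mixture_valuesI:
  fixes n :: nat
  assumes "\<And>k. k \<in> {1..n} \<Longrightarrow> c k \<ge> 0" "(\<Sum>k=1..n. c k) = 1"
    and "\<And>k. k \<in> {1..n} \<Longrightarrow> z k \<in> tuples N \<Omega> \<and> z k 1 = x 1"
    and "\<And>j. j \<in> {2..N} \<Longrightarrow> (\<Sum>k=1..n. c k *\<^sub>R z k j) = x j"
  shows "(\<Sum>k=1..n. c k * K (z k)) \<in> mixture_values N \<Omega> K x"
  unfolding mixture_values_def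
  by (rule CollectI, rule exI[of _ n], rule exI[of _ c], rule exI[of _ z]) (use assms in blast)

lemma mixture_valuesE:
  assumes "v \<in> mixture_values N \<Omega> K x"
  obtains n c z where "v = (\<Sum>k=1..n::nat. c k * K (z k))"
    and "\<And>k. k \<in> {1..n} \<Longrightarrow> c k \<ge> 0" "(\<Sum>k=1..n. c k) = 1"
    and "\<And>k. k \<in> {1..n} \<Longrightarrow> z k \<in> tuples N \<Omega>" "\<And>k. k \<in> {1..n} \<Longrightarrow> z k 1 = x 1"
    and "\<And>j. j \<in> {2..N} \<Longrightarrow> (\<Sum>k=1..n. c k *\<^sub>R z k j) = x j"
  using assms unfolding mixture_values_def by blast

lemma self_in_mixture_values:
  assumes "x \<in> tuples N \<Omega>" shows "K x \<in> mixture_values N \<Omega> K x"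
proof -
  have e: "{1..1::nat} = {1}" by simp
  show ?thesis
    using mixture_valuesI[of 1 "\<lambda>_. 1" "\<lambda>_. x" N \<Omega> x K] assms unfolding e by simp
qed

text \<open>Jensen's inequality: concave majorants of \<open>K\<close> also majorize its concavification.\<close>

lemma mixture_values_le:
  assumes "convex \<Omega>" "N \<ge> 1" "convex_in_others N \<Omega> H" "x \<in> tuples N \<Omega>"
    and K: "\<And>w. w \<in> tuples N \<Omega> \<Longrightarrow> K w \<le> - H w"
    and v: "v \<in> mixture_values N \<Omega> K x"
  shows "v \<le> - H x"
  using v
proof (rule mixture_valuesE)
  fix n c z
  assume v: "v = (\<Sum>k=1..n::nat. c k * K (z k))"
    and c: "\<And>k. k \<in> {1..n} \<Longrightarrow> c k \<ge> 0" "(\<Sum>k=1..n. c k) = 1"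
    and z: "\<And>k. k \<in> {1..n} \<Longrightarrow> z k \<in> tuples N \<Omega>" "\<And>k. k \<in> {1..n} \<Longrightarrow> z k 1 = x 1"
    and x: "\<And>j. j \<in> {2..N} \<Longrightarrow> (\<Sum>k=1..n. c k *\<^sub>R z k j) = x j"
  have ne: "{1..n} \<noteq> {}" using c(2) by force
  have J: "(\<lambda>j\<in>{1..N}. \<Sum>k\<in>{1..n}. c k *\<^sub>R z k j) \<in> tuples N \<Omega> \<and>
    H (\<lambda>j\<in>{1..N}. \<Sum>k\<in>{1..n}. c k *\<^sub>R z k j) \<le> (\<Sum>k\<in>{1..n}. c k * H (z k))"
    by (rule convex_in_others_jensen[OF _ ne assms(1,3,2) c z]) auto
  have "(\<lambda>j\<in>{1..N}. \<Sum>k\<in>{1..n}. c k *\<^sub>R z k j) = x"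
  proof (rule tuples_eqI[OF _ assms(4)])
    fix j assume j: "j \<in> {1..N}"
    have "(\<Sum>k=1..n. c k *\<^sub>R z k 1) = (\<Sum>k=1..n. c k *\<^sub>R x 1)"
      by (intro sum.cong) (use z in auto)
    also have "\<dots> = x 1" using c(2) by (simp flip: scaleR_sum_left)
    finally show "(\<lambda>j\<in>{1..N}. \<Sum>k\<in>{1..n}. c k *\<^sub>R z k j) j = x j"
      using j x[of j] by (cases "j = 1") auto
  qed (use J in blast)
  with J have "H x \<le> (\<Sum>k\<in>{1..n}. c k * H (z k))" by simp
  moreover have "v \<le> (\<Sum>k=1..n. c k * - H (z k))"
    unfolding v by (intro sum_mono mult_left_mono K z c)
  ultimately show ?thesis by (simp add: sum_negf)
qed

lemma sum_concatenate:
  fixes a b :: "nat \<Rightarrow> 'b::comm_monoid_add"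
  shows "(\<Sum>k=1..n + m. if k \<le> n then a k else b (k - n)) = (\<Sum>k=1..n. a k) + (\<Sum>k=1..m. b k)"
proof -
  have "(\<Sum>k=1..n + m. if k \<le> n then a k else b (k - n))
      = (\<Sum>k=1..n. if k \<le> n then a k else b (k - n))
        + (\<Sum>k=n+1..n + m. if k \<le> n then a k else b (k - n))"
    by (rule sum.ub_add_nat) simp
  moreover have "(\<Sum>k=n+1..n + m. if k \<le> n then a k else b (k - n)) = (\<Sum>k=1..m. b k)"
    using sum.shift_bounds_cl_nat_ivl[of "\<lambda>k. if k \<le> n then a k else b (k - n)" 1 n m]
    by (simp add: add.commute)
  ultimately show ?thesis by simp
qed

text \<open>
  Concatenating the points of two competitors, with weights scaled by \<open>s\<close> and \<open>t\<close>, gives a competitor for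
  the convex combination. This is what makes the concavification concave.
\<close>

lemma mixture_values_mix:
  assumes "a \<in> mixture_values N \<Omega> K x" "b \<in> mixture_values N \<Omega> K y" "x 1 = y 1"
    and "N \<ge> 1" and st: "s \<ge> 0" "t \<ge> 0" "s + t = 1"
  shows "s * a + t * b \<in> mixture_values N \<Omega> K (mix N s x t y)"
  using assms(1)
proof (rule mixture_valuesE)
  fix n c z
  assume a: "a = (\<Sum>k=1..n::nat. c k * K (z k))"
    and c: "\<And>k. k \<in> {1..n} \<Longrightarrow> c k \<ge> 0" "(\<Sum>k=1..n. c k) = 1"
    and z: "\<And>k. k \<in> {1..n} \<Longrightarrow> z k \<in> tuples N \<Omega>" "\<And>k. k \<in> {1..n} \<Longrightarrow> z k 1 = x 1"
    and x: "\<And>j. j \<in> {2..N} \<Longrightarrow> (\<Sum>k=1..n. c k *\<^sub>R z k j) = x j"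
  show ?thesis using assms(2)
  proof (rule mixture_valuesE)
    fix m d w
    assume b: "b = (\<Sum>k=1..m::nat. d k * K (w k))"
      and d: "\<And>k. k \<in> {1..m} \<Longrightarrow> d k \<ge> 0" "(\<Sum>k=1..m. d k) = 1"
      and w: "\<And>k. k \<in> {1..m} \<Longrightarrow> w k \<in> tuples N \<Omega>" "\<And>k. k \<in> {1..m} \<Longrightarrow> w k 1 = y 1"
      and y: "\<And>j. j \<in> {2..N} \<Longrightarrow> (\<Sum>k=1..m. d k *\<^sub>R w k j) = y j"
    let ?e = "\<lambda>k. if k \<le> n then s * c k else t * d (k - n)"
    let ?q = "\<lambda>k. if k \<le> n then z k else w (k - n)"
    have first: "mix N s x t y 1 = x 1"
      using assms(3,4) st by (simp add: mix_def flip: scaleR_left_distrib)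
    have "(\<Sum>k=1..n + m. ?e k * K (?q k)) \<in> mixture_values N \<Omega> K (mix N s x t y)"
    proof (rule mixture_valuesI)
      show "(\<Sum>k=1..n + m. ?e k) = 1"
        unfolding sum_concatenate[where n = n and m = m and a = "\<lambda>k. s * c k" and b = "\<lambda>k. t * d k"]
        using c(2) d(2) st by (simp flip: sum_distrib_left)
    next
      fix k assume k: "k \<in> {1..n + m}"
      then have k': "\<not> k \<le> n \<Longrightarrow> k - n \<in> {1..m}" by auto
      show "?e k \<ge> 0" using c(1)[of k] d(1)[OF k'] k st by auto
      show "?q k \<in> tuples N \<Omega> \<and> ?q k 1 = mix N s x t y 1"
        unfolding first using z[of k] w[OF k'] k assms(3) by auto
    next
      fix j assume j: "j \<in> {2..N}"
      have "(\<Sum>k=1..n + m. ?e k *\<^sub>R ?q k j)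
          = (\<Sum>k=1..n + m. if k \<le> n then s *\<^sub>R (c k *\<^sub>R z k j) else t *\<^sub>R (d (k - n) *\<^sub>R w (k - n) j))"
        by (intro sum.cong) auto
      also have "\<dots> = s *\<^sub>R x j + t *\<^sub>R y j"
        unfolding sum_concatenate[where n = n and m = m and a = "\<lambda>k. s *\<^sub>R (c k *\<^sub>R z k j)" and b = "\<lambda>k. t *\<^sub>R (d k *\<^sub>R w k j)"]
          x[OF j, symmetric] y[OF j, symmetric] by (simp only: scaleR_sum_right)
      finally show "(\<Sum>k=1..n + m. ?e k *\<^sub>R ?q k j) = mix N s x t y j" using j by (simp add: mix_def)
    qed
    moreover have "(\<Sum>k=1..n + m. ?e k * K (?q k))
        = (\<Sum>k=1..n + m. if k \<le> n then s * (c k * K (z k)) else t * (d (k - n) * K (w (k - n))))"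
      by (intro sum.cong) auto
    ultimately show ?thesis
      unfolding sum_concatenate[where n = n and m = m and a = "\<lambda>k. s * (c k * K (z k))" and b = "\<lambda>k. t * (d k * K (w k))"] a b
      by (simp only: sum_distrib_left)
  qed
qed

lemma mult_cSup_le:
  fixes A :: "real set"
  assumes "A \<noteq> {}" "s \<ge> 0" "\<And>a. a \<in> A \<Longrightarrow> s * a \<le> b"
  shows "s * Sup A \<le> b"
proof (cases "s = 0")
  case True
  then show ?thesis using assms by auto
next
  case False
  then have "Sup A \<le> b / s" using assms by (intro cSup_least) (auto simp: field_simps)
  with False assms(2) show ?thesis by (simp add: field_simps)
qed

lemma sub_antisymmetric_orbit_sum:
  "sub_antisymmetric N \<Omega> H \<longleftrightarrow> (\<forall>x\<in>tuples N \<Omega>. orbit_sum N H x \<le> 0)"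
  unfolding sub_antisymmetric_def orbit_sum_def ..

section \<open>Averaging towards antisymmetry\<close>

definition sub_antisymmetric_convex ::
  "nat \<Rightarrow> 'a::euclidean_space set \<Rightarrow> ((nat \<Rightarrow> 'a) \<Rightarrow> real) \<Rightarrow> bool" where
  "sub_antisymmetric_convex N \<Omega> H \<longleftrightarrow> sub_antisymmetric N \<Omega> H \<and> convex_in_others N \<Omega> H"

abbreviation (input) rotated_hull ::
  "nat \<Rightarrow> 'a::euclidean_space set \<Rightarrow> ((nat \<Rightarrow> 'a) \<Rightarrow> real) \<Rightarrow> (nat \<Rightarrow> 'a) \<Rightarrow> real" where
  "rotated_hull N \<Omega> H \<equiv> concave_hull N \<Omega> (rotated_sum N H)"

context
  fixes N :: nat and \<Omega> :: "'a::euclidean_space set" and H :: "(nat \<Rightarrow> 'a) \<Rightarrow> real"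
  assumes N: "N \<ge> 1" and conv: "convex \<Omega>" and H: "sub_antisymmetric_convex N \<Omega> H"
begin

lemma rotated_sum_le: "x \<in> tuples N \<Omega> \<Longrightarrow> rotated_sum N H x \<le> - H x"
  using H orbit_sum_split[of N H x]
  unfolding sub_antisymmetric_convex_def sub_antisymmetric_orbit_sum by force

lemma rotated_values_le:
  assumes "x \<in> tuples N \<Omega>" "v \<in> mixture_values N \<Omega> (rotated_sum N H) x"
  shows "v \<le> - H x"
  using mixture_values_le[OF conv N _ assms(1) _ assms(2)] H rotated_sum_le
  by (simp add: sub_antisymmetric_convex_def)

lemma rotated_values_le_hull:
  assumes "x \<in> tuples N \<Omega>" "v \<in> mixture_values N \<Omega> (rotated_sum N H) x"
  shows "v \<le> rotated_hull N \<Omega> H x"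
  unfolding concave_hull_def
  using assms rotated_values_le[OF assms(1)] by (intro cSup_upper bdd_aboveI)

lemma rotated_hull_leI:
  assumes "x \<in> tuples N \<Omega>"
    and "\<And>v. v \<in> mixture_values N \<Omega> (rotated_sum N H) x \<Longrightarrow> v \<le> b"
  shows "rotated_hull N \<Omega> H x \<le> b"
  unfolding concave_hull_def
  using assms(2) self_in_mixture_values[OF assms(1)] by (intro cSup_least) auto

lemma rotated_hull_le: "x \<in> tuples N \<Omega> \<Longrightarrow> rotated_hull N \<Omega> H x \<le> - H x"
  by (rule rotated_hull_leI[OF _ rotated_values_le])

lemma rotated_sum_le_hull: "x \<in> tuples N \<Omega> \<Longrightarrow> rotated_sum N H x \<le> rotated_hull N \<Omega> H x"
  by (rule rotated_values_le_hull[OF _ self_in_mixture_values])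

lemma concavification_eq_rotated_hull:
  assumes x: "x \<in> tuples N \<Omega>"
  shows "concavification N \<Omega> (rotated_sum N H) x = ereal (rotated_hull N \<Omega> H x)"
proof -
  let ?A = "mixture_values N \<Omega> (rotated_sum N H) x"
  have "(SUP v\<in>?A. ereal v) \<le> ereal (- H x)"
    by (intro SUP_least) (use rotated_values_le[OF x] in simp)
  moreover have "ereal (rotated_sum N H x) \<le> (SUP v\<in>?A. ereal v)"
    by (intro SUP_upper self_in_mixture_values x)
  ultimately have "\<bar>SUP v\<in>?A. ereal v\<bar> \<noteq> \<infinity>" by auto
  then show ?thesis unfolding concavification_eq_Sup concave_hull_def by (rule ereal_Sup[symmetric])
qed

lemma rotated_hull_concave_in_others:
  assumes "x \<in> tuples N \<Omega>" "y \<in> tuples N \<Omega>" "x 1 = y 1"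
    and st: "s \<ge> 0" "t \<ge> 0" "s + t = 1"
  shows "s * rotated_hull N \<Omega> H x + t * rotated_hull N \<Omega> H y \<le> rotated_hull N \<Omega> H (mix N s x t y)"
proof -
  let ?V = "mixture_values N \<Omega> (rotated_sum N H)" and ?C = "rotated_hull N \<Omega> H"
  have ne: "?V x \<noteq> {}" "?V y \<noteq> {}" using self_in_mixture_values assms(1,2) by blast+
  have val: "s * a + t * b \<le> ?C (mix N s x t y)" if "a \<in> ?V x" "b \<in> ?V y" for a b
    using mixture_values_mix[OF that assms(3) N st]
    by (rule rotated_values_le_hull[OF mix_in_tuples[OF conv assms(1,2) st]])
  have "s * ?C x \<le> ?C (mix N s x t y) - t * b" if "b \<in> ?V y" for b
    unfolding concave_hull_def[of _ _ _ x] using val[OF _ that]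
    by (intro mult_cSup_le ne st) (simp add: algebra_simps)
  then have "t * b \<le> ?C (mix N s x t y) - s * ?C x" if "b \<in> ?V y" for b
    using that by (simp add: algebra_simps)
  then have "t * ?C y \<le> ?C (mix N s x t y) - s * ?C x"
    unfolding concave_hull_def[of _ _ _ y] by (intro mult_cSup_le ne st)
  then show ?thesis by simp
qed

text \<open>
  Concavifying in the last variables does not destroy convexity in the first one: a competitor for a
  convex combination of \<open>x\<close> and \<open>y\<close> splits, point by point and with the same weights, into competitors for
  \<open>x\<close> and \<open>y\<close>, by exchanging the common first entry of its points.
\<close>

lemma rotated_hull_convex_in_first:
  assumes x: "x \<in> tuples N \<Omega>" and y: "y \<in> tuples N \<Omega>" and xy: "\<And>j. j \<in> {2..N} \<Longrightarrow> x j = y j"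
    and st: "s \<ge> 0" "t \<ge> 0" "s + t = 1"
  shows "rotated_hull N \<Omega> H (mix N s x t y) \<le> s * rotated_hull N \<Omega> H x + t * rotated_hull N \<Omega> H y"
proof (rule rotated_hull_leI[OF mix_in_tuples[OF conv x y st]])
  let ?K = "rotated_sum N H"
  fix v assume "v \<in> mixture_values N \<Omega> ?K (mix N s x t y)"
  then show "v \<le> s * rotated_hull N \<Omega> H x + t * rotated_hull N \<Omega> H y"
  proof (rule mixture_valuesE)
    fix n c z
    assume v: "v = (\<Sum>k=1..n::nat. c k * ?K (z k))"
      and c: "\<And>k. k \<in> {1..n} \<Longrightarrow> c k \<ge> 0" "(\<Sum>k=1..n. c k) = 1"
      and z: "\<And>k. k \<in> {1..n} \<Longrightarrow> z k \<in> tuples N \<Omega>" "\<And>k. k \<in> {1..n} \<Longrightarrow> z k 1 = mix N s x t y 1"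
      and sum: "\<And>j. j \<in> {2..N} \<Longrightarrow> (\<Sum>k=1..n. c k *\<^sub>R z k j) = mix N s x t y j"
    have e: "s *\<^sub>R a + t *\<^sub>R a = a" for a :: 'a using st by (simp flip: scaleR_left_distrib)
    \<comment> \<open>Only the first entry distinguishes the three tuples.\<close>
    have others: "mix N s x t y j = x j" "x j = y j" if "j \<in> {2..N}" for j
      using that xy e by (auto simp: mix_def)
    have one: "1 \<in> {1..N}" using N by simp
    have zx: "(z k)(1 := a 1) \<in> tuples N \<Omega>" if "k \<in> {1..n}" "a \<in> tuples N \<Omega>" for k a
      using tuples_fun_upd[OF z(1)[OF that(1)] one tuples_D[OF that(2) one]] .
    have zk: "z k = mix N s ((z k)(1 := x 1)) t ((z k)(1 := y 1))" if k: "k \<in> {1..n}" for k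
    proof (rule tuples_eqI[OF z(1)[OF k] mix_in_tuples[OF conv zx[OF k x] zx[OF k y] st]])
      fix j assume "j \<in> {1..N}"
      then show "z k j = mix N s ((z k)(1 := x 1)) t ((z k)(1 := y 1)) j"
        using z(2)[OF k] e N by (auto simp: mix_def)
    qed
    have val: "(\<Sum>k=1..n. c k * ?K ((z k)(1 := a 1))) \<le> rotated_hull N \<Omega> H a"
      if a: "a \<in> tuples N \<Omega>" "\<And>j. j \<in> {2..N} \<Longrightarrow> a j = x j" for a
    proof (rule rotated_values_le_hull[OF a(1) mixture_valuesI])
      fix j assume j: "j \<in> {2..N}"
      have "(\<Sum>k=1..n. c k *\<^sub>R ((z k)(1 := a 1)) j) = (\<Sum>k=1..n. c k *\<^sub>R z k j)"
        using j by (intro sum.cong) auto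
      then show "(\<Sum>k=1..n. c k *\<^sub>R ((z k)(1 := a 1)) j) = a j"
        using sum[OF j] others[OF j] a(2)[OF j] by simp
    qed (use c zx a in auto)
    have "v \<le> (\<Sum>k=1..n. c k * (s * ?K ((z k)(1 := x 1)) + t * ?K ((z k)(1 := y 1))))"
      unfolding v
    proof (intro sum_mono mult_left_mono c)
      fix k assume k: "k \<in> {1..n}"
      have "?K (mix N s ((z k)(1 := x 1)) t ((z k)(1 := y 1)))
          \<le> s * ?K ((z k)(1 := x 1)) + t * ?K ((z k)(1 := y 1))"
        by (rule rotated_sum_convex_in_first[OF _ zx[OF k x] zx[OF k y] _ st])
           (use H in \<open>auto simp: sub_antisymmetric_convex_def\<close>)
      then show "?K (z k) \<le> s * ?K ((z k)(1 := x 1)) + t * ?K ((z k)(1 := y 1))"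
        by (subst zk[OF k])
    qed
    also have "\<dots> = s * (\<Sum>k=1..n. c k * ?K ((z k)(1 := x 1))) + t * (\<Sum>k=1..n. c k * ?K ((z k)(1 := y 1)))"
      by (simp add: sum_distrib_left sum.distrib algebra_simps)
    also have "\<dots> \<le> s * rotated_hull N \<Omega> H x + t * rotated_hull N \<Omega> H y"
      using val[OF x] val[OF y] xy st by (intro add_mono mult_left_mono) auto
    finally show ?thesis .
  qed
qed

end

text \<open>
  The mean of \<open>N - 1\<close> copies of \<open>H\<close> and of minus the concavified rotations. With these
  weights \<open>(N - 1) H - K\<close> has orbit sum zero, and a fixed point is a function with \<open>C = - H\<close>.
\<close>

definition average_step ::
  "nat \<Rightarrow> 'a::euclidean_space set \<Rightarrow> ((nat \<Rightarrow> 'a) \<Rightarrow> real) \<Rightarrow> (nat \<Rightarrow> 'a) \<Rightarrow> real" where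
  "average_step N \<Omega> H x = ((real N - 1) * H x - rotated_hull N \<Omega> H x) / real N"

text \<open>
  Along an orbit the concavification is at least the sum of the other rotations, that is the orbit sum
  minus \<open>H\<close>. Hence the step is at most \<open>H\<close> minus the mean of \<open>H\<close> over the orbit, whose orbit sum is zero.
\<close>

lemma average_step_sub_antisymmetric_convex:
  assumes N: "N \<ge> 1" and conv: "convex \<Omega>" and H: "sub_antisymmetric_convex N \<Omega> H"
  shows "sub_antisymmetric_convex N \<Omega> (average_step N \<Omega> H)"
  unfolding sub_antisymmetric_convex_def
proof
  show "sub_antisymmetric N \<Omega> (average_step N \<Omega> H)"
    unfolding sub_antisymmetric_orbit_sum
  proof
    fix x assume x: "x \<in> tuples N \<Omega>"
    let ?r = "\<lambda>i. (cyc N ^^ i) x"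
    have r: "?r i \<in> tuples N \<Omega>" for i by (rule cyc_pow_in_tuples[OF x])
    have "average_step N \<Omega> H (?r i) \<le> H (?r i) - orbit_sum N H x / N" for i
    proof -
      have "- rotated_hull N \<Omega> H (?r i) \<le> H (?r i) - orbit_sum N H x"
        using rotated_sum_le_hull[OF N conv H r[of i]] orbit_sum_split[of N H "?r i"]
          orbit_sum_cyc_pow[OF N x, of H i] by linarith
      then have "average_step N \<Omega> H (?r i) \<le> (real N * H (?r i) - orbit_sum N H x) / N"
        unfolding average_step_def by (intro divide_right_mono) (auto simp: algebra_simps)
      then show ?thesis using N by (simp add: diff_divide_distrib)
    qed
    then have "orbit_sum N (average_step N \<Omega> H) x \<le> (\<Sum>i=0..N - 1. H (?r i) - orbit_sum N H x / N)"
      unfolding orbit_sum_def[of N "average_step N \<Omega> H"] by (intro sum_mono)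
    also have "\<dots> = 0"
      using N by (simp add: sum_subtractf orbit_sum_def of_nat_diff)
    finally show "orbit_sum N (average_step N \<Omega> H) x \<le> 0" .
  qed
  show "convex_in_others N \<Omega> (average_step N \<Omega> H)"
  proof (rule convex_in_othersI[OF N])
    fix x y s t
    assume x: "x \<in> tuples N \<Omega>" and y: "y \<in> tuples N \<Omega>" and xy: "x 1 = y 1"
      and st: "(0::real) \<le> s" "(0::real) \<le> t" "s + t = 1"
    have "(real N - 1) * H (mix N s x t y) \<le> (real N - 1) * (s * H x + t * H y)"
      using convex_in_othersD[OF _ N x y xy st] H N
      by (intro mult_left_mono) (auto simp: sub_antisymmetric_convex_def)
    moreover note rotated_hull_concave_in_others[OF N conv H x y xy st]
    ultimately have "(real N - 1) * H (mix N s x t y) - rotated_hull N \<Omega> H (mix N s x t y)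
       \<le> s * ((real N - 1) * H x - rotated_hull N \<Omega> H x) + t * ((real N - 1) * H y - rotated_hull N \<Omega> H y)"
      by (simp add: algebra_simps)
    then have "((real N - 1) * H (mix N s x t y) - rotated_hull N \<Omega> H (mix N s x t y)) / N
       \<le> (s * ((real N - 1) * H x - rotated_hull N \<Omega> H x) + t * ((real N - 1) * H y - rotated_hull N \<Omega> H y)) / N"
      by (rule divide_right_mono) simp
    then show "average_step N \<Omega> H (mix N s x t y)
        \<le> s * average_step N \<Omega> H x + t * average_step N \<Omega> H y"
      by (simp add: average_step_def add_divide_distrib)
  qed
qed

lemma average_step_ge:
  assumes N: "N \<ge> 1" and conv: "convex \<Omega>" and H: "sub_antisymmetric_convex N \<Omega> H"
    and x: "x \<in> tuples N \<Omega>"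
  shows "H x \<le> average_step N \<Omega> H x"
  using rotated_hull_le[OF N conv H x] N by (simp add: average_step_def field_simps)

lemma rotated_hull_mono:
  assumes N: "N \<ge> 1" and conv: "convex \<Omega>"
    and F: "sub_antisymmetric_convex N \<Omega> F" and H: "sub_antisymmetric_convex N \<Omega> H"
    and FH: "\<And>w. w \<in> tuples N \<Omega> \<Longrightarrow> F w \<le> H w" and x: "x \<in> tuples N \<Omega>"
  shows "rotated_hull N \<Omega> F x \<le> rotated_hull N \<Omega> H x"
proof (rule rotated_hull_leI[OF N conv F x])
  fix v assume "v \<in> mixture_values N \<Omega> (rotated_sum N F) x"
  then show "v \<le> rotated_hull N \<Omega> H x"
  proof (rule mixture_valuesE)
    fix n c z
    assume v: "v = (\<Sum>k=1..n::nat. c k * rotated_sum N F (z k))"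
      and c: "\<And>k. k \<in> {1..n} \<Longrightarrow> c k \<ge> 0" "(\<Sum>k=1..n. c k) = 1"
      and z: "\<And>k. k \<in> {1..n} \<Longrightarrow> z k \<in> tuples N \<Omega>" "\<And>k. k \<in> {1..n} \<Longrightarrow> z k 1 = x 1"
      and sum: "\<And>j. j \<in> {2..N} \<Longrightarrow> (\<Sum>k=1..n. c k *\<^sub>R z k j) = x j"
    have "v \<le> (\<Sum>k=1..n. c k * rotated_sum N H (z k))"
      unfolding v by (intro sum_mono mult_left_mono c FH cyc_pow_in_tuples z)
    also have "\<dots> \<le> rotated_hull N \<Omega> H x"
      by (intro rotated_values_le_hull[OF N conv H x] mixture_valuesI) (use c z sum in auto)
    finally show ?thesis .
  qed
qed

text \<open>
  The limit \<open>H\<close> of the iterates \<open>A n\<close>. The recursion expresses the concavification belonging to \<open>A n\<close>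
  through two consecutive iterates, so it converges to \<open>- H\<close>; by monotonicity it stays below the
  concavification belonging to \<open>H\<close>, which is therefore at least \<open>- H\<close>.
\<close>

lemma exists_antisymmetric_majorant:
  fixes F :: "(nat \<Rightarrow> 'a::euclidean_space) \<Rightarrow> real"
  assumes N: "N \<ge> 1" and conv: "convex \<Omega>" and F: "sub_antisymmetric_convex N \<Omega> F"
  obtains H where "sub_antisymmetric_convex N \<Omega> H" "concave_in_first N \<Omega> H"
    "\<And>x. x \<in> tuples N \<Omega> \<Longrightarrow> F x \<le> H x"
    "\<And>x. x \<in> tuples N \<Omega> \<Longrightarrow> concavification N \<Omega> (rotated_sum N H) x = ereal (- H x)"
proof -
  define A where "A n = (average_step N \<Omega> ^^ n) F" for n
  have A0: "A 0 = F" and ASuc: "A (Suc n) = average_step N \<Omega> (A n)" for n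
    by (auto simp: A_def)
  have A: "sub_antisymmetric_convex N \<Omega> (A n)" for n
    by (induction n) (auto simp: A0 ASuc F intro: average_step_sub_antisymmetric_convex[OF N conv])
  have inc: "A n x \<le> A (Suc n) x" if "x \<in> tuples N \<Omega>" for n x
    unfolding ASuc by (rule average_step_ge[OF N conv A that])
  have mono: "m \<le> n \<Longrightarrow> A m x \<le> A n x" if "x \<in> tuples N \<Omega>" for m n x
    using lift_Suc_mono_le[of "\<lambda>n. A n x"] inc[OF that] by blast
  define H where "H x = lim (\<lambda>n. A n x)" for x
  have lim: "(\<lambda>n. A n x) \<longlonglongrightarrow> H x" if x: "x \<in> tuples N \<Omega>" for x
  proof -
    have "A n x \<le> - rotated_sum N F x" for n
    proof -
      have "rotated_sum N F x \<le> rotated_sum N (A n) x"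
        using mono[OF cyc_pow_in_tuples[OF x], of 0 n] by (intro sum_mono) (simp add: A0)
      then show ?thesis using rotated_sum_le[OF N conv A x, of n] by linarith
    qed
    moreover have "incseq (\<lambda>n. A n x)" using mono[OF x] by (simp add: incseq_def)
    ultimately have "convergent (\<lambda>n. A n x)" by (metis incseq_convergent convergentI)
    then show ?thesis unfolding H_def by (simp add: convergent_LIMSEQ_iff)
  qed
  have AH: "A n x \<le> H x" if "x \<in> tuples N \<Omega>" for n x
    using mono[OF that] by (intro incseq_le[OF _ lim[OF that]]) (simp add: incseq_def)
  have H: "sub_antisymmetric_convex N \<Omega> H"
    unfolding sub_antisymmetric_convex_def
  proof
    show "sub_antisymmetric N \<Omega> H"
      unfolding sub_antisymmetric_def
    proof
      fix x assume x: "x \<in> tuples N \<Omega>"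
      have "(\<lambda>n. \<Sum>i=0..N - 1. A n ((cyc N ^^ i) x)) \<longlonglongrightarrow> (\<Sum>i=0..N - 1. H ((cyc N ^^ i) x))"
        by (intro tendsto_sum lim cyc_pow_in_tuples x)
      moreover have "(\<Sum>i=0..N - 1. A n ((cyc N ^^ i) x)) \<le> 0" for n
        using A x unfolding sub_antisymmetric_convex_def sub_antisymmetric_def by blast
      ultimately show "(\<Sum>i=0..N - 1. H ((cyc N ^^ i) x)) \<le> 0" by (intro LIMSEQ_le_const2) auto
    qed
    show "convex_in_others N \<Omega> H"
    proof (rule convex_in_othersI[OF N])
      fix x y s t
      assume x: "x \<in> tuples N \<Omega>" and y: "y \<in> tuples N \<Omega>" and xy: "x 1 = y 1"
        and st: "(0::real) \<le> s" "(0::real) \<le> t" "s + t = 1"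
      have "A n (mix N s x t y) \<le> s * A n x + t * A n y" for n
        using A convex_in_othersD[OF _ N x y xy st] by (simp add: sub_antisymmetric_convex_def)
      moreover have "(\<lambda>n. s * A n x + t * A n y) \<longlonglongrightarrow> s * H x + t * H y"
        by (intro tendsto_intros lim x y)
      ultimately show "H (mix N s x t y) \<le> s * H x + t * H y"
        by (intro LIMSEQ_le[OF lim[OF mix_in_tuples[OF conv x y st]]]) auto
    qed
  qed
  have hull: "rotated_hull N \<Omega> H x = - H x" if x: "x \<in> tuples N \<Omega>" for x
  proof (rule antisym[OF rotated_hull_le[OF N conv H x]])
    have "rotated_hull N \<Omega> (A n) x = (real N - 1) * A n x - real N * A (Suc n) x" for n
      using N by (simp add: ASuc average_step_def)
    moreover have "(\<lambda>n. (real N - 1) * A n x - real N * A (Suc n) x)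
        \<longlonglongrightarrow> (real N - 1) * H x - real N * H x"
      by (intro tendsto_intros lim[OF x] LIMSEQ_Suc)
    moreover have "(real N - 1) * H x - real N * H x = - H x" by (simp add: algebra_simps)
    ultimately have "(\<lambda>n. rotated_hull N \<Omega> (A n) x) \<longlonglongrightarrow> - H x" by (simp only:)
    moreover have "rotated_hull N \<Omega> (A n) x \<le> rotated_hull N \<Omega> H x" for n
      by (rule rotated_hull_mono[OF N conv A H AH x])
    ultimately show "- H x \<le> rotated_hull N \<Omega> H x" by (intro LIMSEQ_le_const2) auto
  qed
  have "concave_in_first N \<Omega> H"
  proof (rule concave_in_firstI[OF N conv])
    fix x y s t
    assume x: "x \<in> tuples N \<Omega>" and y: "y \<in> tuples N \<Omega>" and xy: "\<And>j. j \<in> {2..N} \<Longrightarrow> x j = y j"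
      and st: "(0::real) \<le> s" "(0::real) \<le> t" "s + t = 1"
    show "s * H x + t * H y \<le> H (mix N s x t y)"
      using rotated_hull_convex_in_first[OF N conv H x y xy st] hull[OF x] hull[OF y]
        hull[OF mix_in_tuples[OF conv x y st]] by simp
  qed
  then show ?thesis
    using that[OF H _ _ ] AH[of _ 0] A0 concavification_eq_rotated_hull[OF N conv H] hull by simp
qed

section \<open>Monotone fields are continuous almost everywhere\<close>

text \<open>
  Integrate the indicator of \<open>D\<close> over \<open>(x, t) \<mapsto> x + t e\<close>. Integrating in \<open>t\<close> first gives zero, integrating
  in \<open>x\<close> first gives the measure of \<open>D\<close> times the infinite length of the line, by translation invariance.
\<close>

lemma null_set_of_countable_lines:
  fixes D :: "'a::euclidean_space set"
  assumes D: "D \<in> sets borel" and line: "\<And>x. countable {t::real. x + t *\<^sub>R e \<in> D}"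
  shows "D \<in> null_sets lborel"
proof -
  let ?f = "\<lambda>(x::'a) (t::real). indicator D (x + t *\<^sub>R e) :: ennreal"
  have [measurable]: "D \<in> sets borel" by fact
  have meas: "case_prod ?f \<in> borel_measurable (lborel \<Otimes>\<^sub>M lborel)"
    unfolding case_prod_unfold by measurable
  have "(\<integral>\<^sup>+t. ?f x t \<partial>lborel) = 0" for x
  proof -
    have "{t. x + t *\<^sub>R e \<in> D} \<in> null_sets lborel"
      by (rule countable_imp_null_set_lborel[OF line])
    moreover have "?f x t = indicator {t. x + t *\<^sub>R e \<in> D} t" for t by (simp add: indicator_def)
    ultimately show ?thesis by (simp add: nn_integral_indicator null_setsD1 null_setsD2)
  qed
  moreover have "(\<integral>\<^sup>+x. ?f x t \<partial>lborel) = emeasure lborel D" for t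
  proof -
    have "(\<integral>\<^sup>+x. ?f x t \<partial>lborel) = (\<integral>\<^sup>+x. indicator D (t *\<^sub>R e + x) \<partial>lborel)"
      by (simp add: add.commute)
    also have "\<dots> = (\<integral>\<^sup>+x. indicator D x \<partial>distr lborel borel ((+) (t *\<^sub>R e)))"
      by (subst nn_integral_distr) auto
    also have "\<dots> = emeasure lborel D"
      unfolding lborel_distr_plus using D by simp
    finally show ?thesis .
  qed
  ultimately have "emeasure lborel D * emeasure lborel (UNIV::real set) = 0"
    using lborel_pair.Fubini'[OF meas] by simp
  then have "emeasure lborel D = 0" by (simp add: emeasure_lborel_UNIV)
  with D show ?thesis by (auto intro: null_setsI)
qed

definition monotone_field :: "'a::real_inner set \<Rightarrow> ('a \<Rightarrow> 'a) \<Rightarrow> bool" where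
  "monotone_field \<Omega> T \<longleftrightarrow> (\<forall>x\<in>\<Omega>. \<forall>y\<in>\<Omega>. (T y - T x) \<bullet> (y - x) \<ge> 0)"

text \<open>
  Monotonicity between \<open>z\<close> and \<open>y = x + t e\<close> compares the components along \<open>e\<close> up to an error
  \<open>2 B |z - x| / |t|\<close>. For \<open>z\<close> much closer to \<open>x\<close> than \<open>|t|\<close>, the value at \<open>z\<close> is thus squeezed between the
  values at \<open>x - t e\<close> and \<open>x + t e\<close>.
\<close>

lemma isCont_component_of_line:
  fixes T :: "'a::euclidean_space \<Rightarrow> 'a"
  assumes "open \<Omega>" "x \<in> \<Omega>" and mono: "monotone_field \<Omega> T"
    and bd: "\<And>y. y \<in> \<Omega> \<Longrightarrow> norm (T y) \<le> B"
    and line: "continuous (at 0 within {t. x + t *\<^sub>R e \<in> \<Omega>}) (\<lambda>t. T (x + t *\<^sub>R e) \<bullet> e)"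
  shows "isCont (\<lambda>z. T z \<bullet> e) x"
proof -
  let ?g = "\<lambda>t. T (x + t *\<^sub>R e) \<bullet> e"
  have B: "B \<ge> 0" using bd[OF assms(2)] norm_ge_zero order_trans by blast
  have bound: "(?g t - T z \<bullet> e) * t \<ge> - (2 * B * dist z x)"
    if "z \<in> \<Omega>" "x + t *\<^sub>R e \<in> \<Omega>" for z t
  proof -
    let ?y = "x + t *\<^sub>R e"
    have "0 \<le> (T ?y - T z) \<bullet> (?y - z)"
      using mono that unfolding monotone_field_def by blast
    also have "\<dots> = (?g t - T z \<bullet> e) * t + (T ?y - T z) \<bullet> (x - z)"
      by (simp add: inner_diff_left inner_diff_right inner_add_right algebra_simps)
    also have "(T ?y - T z) \<bullet> (x - z) \<le> (2 * B) * dist z x"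
    proof -
      have "norm (T ?y - T z) \<le> 2 * B" using bd[OF that(1)] bd[OF that(2)] norm_triangle_ineq4[of "T ?y" "T z"] by simp
      then show ?thesis
        using norm_cauchy_schwarz[of "T ?y - T z" "x - z"]
          mult_right_mono[of "norm (T ?y - T z)" "2 * B" "norm (x - z)"]
        by (simp add: dist_norm norm_minus_commute)
    qed
    finally show ?thesis by simp
  qed
  show ?thesis
    unfolding continuous_at_eps_delta
  proof (intro allI impI)
    fix \<epsilon> :: real assume \<epsilon>: "\<epsilon> > 0"
    obtain r where r: "r > 0" "ball x r \<subseteq> \<Omega>" using assms(1,2) openE by blast
    obtain \<delta> where \<delta>: "\<delta> > 0"
      "\<And>t. x + t *\<^sub>R e \<in> \<Omega> \<Longrightarrow> \<bar>t\<bar> < \<delta> \<Longrightarrow> \<bar>?g t - T x \<bullet> e\<bar> < \<epsilon> / 2"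
      using line[unfolded continuous_within_eps_delta, rule_format, of "\<epsilon> / 2"] \<epsilon>
      by (auto simp: dist_real_def)
    \<comment> \<open>Small enough for \<open>x \<plusminus> t e\<close> to stay in \<open>\<Omega>\<close>; adding 1 to the norm covers \<open>e = 0\<close>.\<close>
    define t where "t = min (\<delta> / 2) (r / (2 * (norm e + 1)))"
    have ne: "norm e + 1 > 0" using norm_ge_zero[of e] by linarith
    have t: "t > 0" "t < \<delta>" using \<delta>(1) r(1) ne by (auto simp: t_def)
    have "t * norm e \<le> r / (2 * (norm e + 1)) * (norm e + 1)"
      using t(1) by (intro mult_mono) (auto simp: t_def)
    also have "\<dots> = r / 2" using ne by (simp add: field_simps)
    also have "\<dots> < r" using r(1) by simp
    finally have "x + t *\<^sub>R e \<in> \<Omega>" "x + (- t) *\<^sub>R e \<in> \<Omega>"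
      using t(1) by (auto intro!: subsetD[OF r(2)] simp: dist_norm)
    note in\<Omega> = this
    define \<eta> where "\<eta> = min r (\<epsilon> * t / (4 * (B + 1)))"
    have "\<eta> > 0" using r(1) \<epsilon> t(1) B by (auto simp: \<eta>_def)
    moreover have "\<bar>T z \<bullet> e - T x \<bullet> e\<bar> < \<epsilon>" if z: "dist z x < \<eta>" for z
    proof -
      have z\<Omega>: "z \<in> \<Omega>" using z by (auto intro!: subsetD[OF r(2)] simp: \<eta>_def dist_commute)
      have "2 * B * dist z x \<le> 2 * (B + 1) * dist z x"
        by (intro mult_right_mono) auto
      also have "\<dots> < 2 * (B + 1) * (\<epsilon> * t / (4 * (B + 1)))"
        using z B by (intro mult_strict_left_mono) (auto simp: \<eta>_def)
      also have "\<dots> = (\<epsilon> / 2) * t" using B by (simp add: field_simps)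
      finally have small: "2 * B * dist z x < (\<epsilon> / 2) * t" .
      have "(T z \<bullet> e - ?g t) * t < (\<epsilon> / 2) * t"
        using bound[OF z\<Omega> in\<Omega>(1)] small by (simp add: algebra_simps)
      then have "T z \<bullet> e - ?g t < \<epsilon> / 2" using t(1) by simp
      moreover have "(?g (- t) - T z \<bullet> e) * t < (\<epsilon> / 2) * t"
        using bound[OF z\<Omega> in\<Omega>(2)] small by (simp add: algebra_simps)
      then have "?g (- t) - T z \<bullet> e < \<epsilon> / 2" using t(1) by simp
      ultimately show ?thesis
        using \<delta>(2)[OF in\<Omega>(1)] \<delta>(2)[OF in\<Omega>(2)] t by linarith
    qed
    ultimately show "\<exists>d>0. \<forall>z. dist z x < d \<longrightarrow> dist (T z \<bullet> e) (T x \<bullet> e) < \<epsilon>"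
      unfolding dist_real_def by blast
  qed
qed

text \<open>
  The discontinuity set of a component along \<open>e\<close> is Borel, and by the previous lemma its sections
  parallel to \<open>e\<close> lie in the jump sets of monotone functions of one real variable.
\<close>

lemma monotone_field_AE_isCont:
  fixes T :: "'a::euclidean_space \<Rightarrow> 'a"
  assumes \<Omega>: "open \<Omega>" and mono: "monotone_field \<Omega> T" and bd: "bounded (T ` \<Omega>)"
  shows "AE x in lborel. x \<in> \<Omega> \<longrightarrow> isCont T x"
proof -
  obtain B where B: "\<And>y. y \<in> \<Omega> \<Longrightarrow> norm (T y) \<le> B" using bd by (auto simp: bounded_iff)
  let ?D = "\<lambda>e. {x \<in> \<Omega>. \<not> isCont (\<lambda>z. T z \<bullet> e) x}"
  have null: "?D e \<in> null_sets lborel" for e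
  proof (rule null_set_of_countable_lines[where e = e])
    show "?D e \<in> sets borel"
      using \<Omega> isCont_borel[of "\<lambda>z. T z \<bullet> e"]
      by (simp add: Collect_conj_eq Collect_neg_eq)
    fix x
    let ?A = "{t. x + t *\<^sub>R e \<in> \<Omega>}" and ?g = "\<lambda>t. T (x + t *\<^sub>R e) \<bullet> e"
    have "mono_on ?A ?g"
    proof (rule mono_onI)
      fix s t assume st: "s \<in> ?A" "t \<in> ?A" "s \<le> t"
      have "0 \<le> (T (x + t *\<^sub>R e) - T (x + s *\<^sub>R e)) \<bullet> ((x + t *\<^sub>R e) - (x + s *\<^sub>R e))"
        using mono st unfolding monotone_field_def by blast
      also have "\<dots> = (?g t - ?g s) * (t - s)"
        by (simp add: inner_diff_left inner_diff_right inner_add_right algebra_simps)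
      finally have "s < t \<Longrightarrow> 0 \<le> ?g t - ?g s" by (simp add: zero_le_mult_iff)
      then show "?g s \<le> ?g t" using st(3) by (cases "s = t") auto
    qed
    then have "countable {t \<in> ?A. \<not> continuous (at t within ?A) ?g}"
      by (rule mono_on_ctble_discont)
    moreover have "{t. x + t *\<^sub>R e \<in> ?D e} \<subseteq> {t \<in> ?A. \<not> continuous (at t within ?A) ?g}"
    proof safe
      fix t assume t: "x + t *\<^sub>R e \<in> \<Omega>" "\<not> isCont (\<lambda>z. T z \<bullet> e) (x + t *\<^sub>R e)"
        "continuous (at t within ?A) ?g"
      have "continuous (at 0 within {s. (x + t *\<^sub>R e) + s *\<^sub>R e \<in> \<Omega>})
          (\<lambda>s. T ((x + t *\<^sub>R e) + s *\<^sub>R e) \<bullet> e)"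
        unfolding continuous_within_eps_delta
      proof (intro allI impI)
        fix \<epsilon> :: real assume "\<epsilon> > 0"
        then obtain d where d: "d > 0" "\<And>s. s \<in> ?A \<Longrightarrow> dist s t < d \<Longrightarrow> dist (?g s) (?g t) < \<epsilon>"
          using t(3) unfolding continuous_within_eps_delta by blast
        show "\<exists>d>0. \<forall>s\<in>{s. (x + t *\<^sub>R e) + s *\<^sub>R e \<in> \<Omega>}. dist s 0 < d \<longrightarrow>
            dist (T ((x + t *\<^sub>R e) + s *\<^sub>R e) \<bullet> e) (T ((x + t *\<^sub>R e) + 0 *\<^sub>R e) \<bullet> e) < \<epsilon>"
          using d(1) d(2)[of "t + s" for s]
          by (intro exI[of _ d]) (auto simp: dist_real_def scaleR_add_left add.assoc)
      qed
      then show False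
        using isCont_component_of_line[OF \<Omega> t(1) mono B] t(2) by blast
    qed
    ultimately show "countable {t. x + t *\<^sub>R e \<in> ?D e}" by (rule countable_subset[rotated])
  qed
  have "AE x in lborel. x \<in> \<Omega> \<longrightarrow> isCont (\<lambda>z. T z \<bullet> e) x" for e
    by (rule AE_I'[OF null[of e]]) auto
  then have "AE x in lborel. \<forall>e\<in>Basis. x \<in> \<Omega> \<longrightarrow> isCont (\<lambda>z. T z \<bullet> e) x"
    by (subst AE_finite_all) auto
  then show ?thesis
  proof eventually_elim
    case (elim x)
    then show ?case
      unfolding isCont_def by (auto intro!: tendsto_componentwise_iff[THEN iffD2])
  qed
qed

section \<open>The gap functional of a tuple of fields\<close>

definition field_gap :: "nat \<Rightarrow> (nat \<Rightarrow> 'a::real_inner \<Rightarrow> 'a) \<Rightarrow> (nat \<Rightarrow> 'a) \<Rightarrow> real" where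
  "field_gap N u w = (\<Sum>l=1..N - 1. u l (w 1) \<bullet> (w (l + 1) - w 1))"

lemma field_gap_cyc_pow:
  assumes "w \<in> tuples N S" "i < N"
  shows "field_gap N u ((cyc N ^^ i) w)
    = (\<Sum>l=1..N - 1. u l (w (i + 1)) \<bullet> (w ((l + i) mod N + 1) - w (i + 1)))"
proof -
  have "(cyc N ^^ i) w 1 = w (i + 1)" using cyc_pow_nth[OF assms(1), of 1 i] assms(2) by simp
  moreover have "(cyc N ^^ i) w (l + 1) = w ((l + i) mod N + 1)" if "l \<in> {1..N - 1}" for l
    using cyc_pow_nth[OF assms(1), of "l + 1" i] that by auto
  ultimately show ?thesis unfolding field_gap_def by (intro sum.cong) auto
qed

text \<open>
  The points \<open>x\<^sub>1, \<dots>, x\<^bsub>2N-1\<^esub>\<close> of a cycle are those of an \<open>N\<close>-tuple \<open>w\<close>, continued periodically; the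
  indices start at 1, hence the shifts around \<open>mod\<close>.
\<close>

lemma cycle_sum_eq:
  assumes w: "w \<in> tuples N S" and "N \<ge> 1"
    and x: "\<And>j. j \<in> {1..2 * N - 1} \<Longrightarrow> x j = w ((j - 1) mod N + 1)"
  shows "(\<Sum>i=1..N. \<Sum>l=1..N - 1. u l (x i) \<bullet> (x i - x (l + i))) = - orbit_sum N (field_gap N u) w"
proof -
  have e: "{0..N - 1} = {..<N}" using assms(2) by auto
  have "(\<Sum>l=1..N - 1. u l (x (Suc i)) \<bullet> (x (Suc i) - x (l + Suc i))) = - field_gap N u ((cyc N ^^ i) w)"
    if i: "i < N" for i
  proof -
    have "x (Suc i) = w (i + 1)" using x[of "Suc i"] i by auto
    moreover have "x (l + Suc i) = w ((l + i) mod N + 1)" if "l \<in> {1..N - 1}" for l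
      using x[of "l + Suc i"] i that by auto
    ultimately show ?thesis
      unfolding field_gap_cyc_pow[OF w i] sum_negf[symmetric]
      by (intro sum.cong) (auto simp: inner_diff_right)
  qed
  then have "(\<Sum>i<N. \<Sum>l=1..N - 1. u l (x (Suc i)) \<bullet> (x (Suc i) - x (l + Suc i)))
      = (\<Sum>i<N. - field_gap N u ((cyc N ^^ i) w))"
    by (intro sum.cong) auto
  moreover have "(\<Sum>i=1..N. \<Sum>l=1..N - 1. u l (x i) \<bullet> (x i - x (l + i)))
      = (\<Sum>i<N. \<Sum>l=1..N - 1. u l (x (Suc i)) \<bullet> (x (Suc i) - x (l + Suc i)))"
    unfolding One_nat_def by (rule sum.atLeast1_atMost_eq)
  ultimately show ?thesis unfolding orbit_sum_def e by (simp only: sum_negf)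
qed

lemma jointly_monotone_iff_sub_antisymmetric:
  assumes N: "N \<ge> 1"
  shows "jointly_monotone N \<Omega> u \<longleftrightarrow> sub_antisymmetric N \<Omega> (field_gap N u)"
  unfolding sub_antisymmetric_orbit_sum
proof
  assume u: "jointly_monotone N \<Omega> u"
  show "\<forall>w\<in>tuples N \<Omega>. orbit_sum N (field_gap N u) w \<le> 0"
  proof
    fix w assume w: "w \<in> tuples N \<Omega>"
    let ?x = "\<lambda>j. w ((j - 1) mod N + 1)"
    have "?x j \<in> \<Omega>" for j
      using tuples_D[OF w, of "(j - 1) mod N + 1"] N by (auto simp: Suc_leI)
    moreover have "?x (N + i) = ?x i" if "i \<in> {1..N - 1}" for i
    proof -
      have "(N + i - 1) mod N = (N + (i - 1)) mod N" using that by auto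
      then show ?thesis unfolding mod_add_self1 by simp
    qed
    ultimately have "(\<Sum>i=1..N. \<Sum>l=1..N - 1. u l (?x i) \<bullet> (?x i - ?x (l + i))) \<ge> 0"
      using u[unfolded jointly_monotone_def, rule_format, of ?x] by blast
    then show "orbit_sum N (field_gap N u) w \<le> 0"
      using cycle_sum_eq[OF w N, of ?x u] by simp
  qed
next
  assume u: "\<forall>w\<in>tuples N \<Omega>. orbit_sum N (field_gap N u) w \<le> 0"
  show "jointly_monotone N \<Omega> u"
    unfolding jointly_monotone_def
  proof (intro allI impI)
    fix x assume x: "(\<forall>i\<in>{1..2 * N - 1}. x i \<in> \<Omega>) \<and> (\<forall>i\<in>{1..N - 1}. x (N + i) = x i)"
    let ?w = "\<lambda>i\<in>{1..N}. x i"
    have w: "?w \<in> tuples N \<Omega>" by (rule tuples_restrictI) (use x in auto)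
    have "x j = ?w ((j - 1) mod N + 1)" if j: "j \<in> {1..2 * N - 1}" for j
    proof (cases "j \<le> N")
      case True
      then have "(j - 1) mod N + 1 = j" using j by auto
      with True j show ?thesis by simp
    next
      case False
      then have i: "j - N \<in> {1..N - 1}" "N + (j - N) = j" using j by auto
      then have "(j - 1) mod N = (N + (j - N - 1)) mod N" by (intro arg_cong2[of _ _ _ _ "(mod)"]) auto
      also have "\<dots> = j - N - 1" unfolding mod_add_self1 using i by auto
      finally have "(j - 1) mod N + 1 = j - N" using i by auto
      moreover have "x (N + (j - N)) = x (j - N)" using x i(1) by blast
      moreover have "j - N \<in> {1..N}" using i(1) by auto
      ultimately show ?thesis using i(2) by simp
    qed
    then show "0 \<le> (\<Sum>i=1..N. \<Sum>l=1..N - 1. u l (x i) \<bullet> (x i - x (l + i)))"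
      using cycle_sum_eq[OF w N, of x u] u w by simp
  qed
qed

lemma sum_mod_shift:
  fixes g :: "nat \<Rightarrow> 'b::ab_group_add"
  shows "(\<Sum>i<N. g ((l + i) mod N)) = (\<Sum>i<N. g i)"
proof (induction l)
  case (Suc l)
  have "(\<Sum>i<N. g ((Suc l + i) mod N)) = (\<Sum>i<Suc N. g ((l + i) mod N)) - g (l mod N)"
    by (subst sum.lessThan_Suc_shift) simp
  also have "\<dots> = (\<Sum>i<N. g ((l + i) mod N))" by simp
  finally show ?case using Suc by simp
qed simp

text \<open>For constant fields, every entry of \<open>w\<close> occurs equally often with both signs.\<close>

lemma orbit_sum_field_gap_const:
  assumes w: "w \<in> tuples N S" and N: "N \<ge> 1"
  shows "orbit_sum N (field_gap N (\<lambda>l _. c l)) w = 0"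
proof -
  have e: "{0..N - 1} = {..<N}" using N by auto
  have "orbit_sum N (field_gap N (\<lambda>l _. c l)) w
      = (\<Sum>i<N. \<Sum>l=1..N - 1. c l \<bullet> (w ((l + i) mod N + 1) - w (i + 1)))"
    unfolding orbit_sum_def e by (intro sum.cong refl field_gap_cyc_pow[OF w]) simp
  also have "\<dots> = (\<Sum>l=1..N - 1. c l \<bullet> ((\<Sum>i<N. w ((l + i) mod N + 1)) - (\<Sum>i<N. w (i + 1))))"
    by (subst sum.swap) (simp add: inner_sum_right inner_diff_right sum_subtractf)
  also have "\<dots> = 0"
    using sum_mod_shift[of "\<lambda>i. w (i + 1)" _ N] by simp
  finally show ?thesis .
qed

lemma convex_in_others_field_gap:
  assumes "N \<ge> 1"
  shows "convex_in_others N \<Omega> (field_gap N u)"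
proof (rule convex_in_othersI[OF assms])
  fix x y :: "nat \<Rightarrow> 'a" and s t :: real
  assume xy: "x 1 = y 1" and st: "s \<ge> 0" "t \<ge> 0" "s + t = 1"
  have one: "mix N s x t y 1 = y 1"
    using xy assms st by (simp add: mix_def flip: scaleR_left_distrib)
  have "u l (mix N s x t y 1) \<bullet> (mix N s x t y (l + 1) - mix N s x t y 1)
      = s * (u l (x 1) \<bullet> (x (l + 1) - x 1)) + t * (u l (y 1) \<bullet> (y (l + 1) - y 1))"
    if l: "l \<in> {1..N - 1}" for l
  proof -
    have "mix N s x t y (l + 1) - y 1 = s *\<^sub>R x (l + 1) + t *\<^sub>R y (l + 1) - (s + t) *\<^sub>R y 1"
      using l st by (auto simp: mix_def)
    also have "\<dots> = s *\<^sub>R (x (l + 1) - y 1) + t *\<^sub>R (y (l + 1) - y 1)"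
      by (simp add: algebra_simps)
    finally show ?thesis unfolding one xy by (simp add: inner_add_right)
  qed
  then have "field_gap N u (mix N s x t y)
      = (\<Sum>l=1..N - 1. s * (u l (x 1) \<bullet> (x (l + 1) - x 1)) + t * (u l (y 1) \<bullet> (y (l + 1) - y 1)))"
    unfolding field_gap_def by (rule sum.cong[OF refl])
  then show "field_gap N u (mix N s x t y) \<le> s * field_gap N u x + t * field_gap N u y"
    by (simp add: field_gap_def sum.distrib sum_distrib_left)
qed

section \<open>Continuity of jointly monotone fields\<close>

text \<open>
  Joint monotonicity is applied to the cycle \<open>w\<close> with \<open>y\<close> in position \<open>N\<close> and \<open>p\<^sub>k\<close> in position \<open>N - k\<close>. In that
  position the field evaluated at \<open>p\<^sub>k\<close> and paired with \<open>y\<close> is \<open>u\<^sub>k\<close>. Replacing the points \<open>p\<^sub>k\<close> by \<open>x\<close> in the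
  differences, but not in the arguments of the fields, costs the error term and leaves only the pairings
  of \<open>x\<close> with \<open>y\<close>. The freedom to choose each \<open>p\<^sub>k\<close> separately is what gives access to single fields.
\<close>

lemma two_point_cycle:
  assumes N: "N \<ge> 2" and mono: "jointly_monotone N \<Omega> u"
    and M: "\<And>l y. l \<in> {1..N - 1} \<Longrightarrow> y \<in> \<Omega> \<Longrightarrow> norm (u l y) \<le> M"
    and x: "x \<in> \<Omega>" and y: "y \<in> \<Omega>" and p: "\<And>k. k \<in> {1..N - 1} \<Longrightarrow> p k \<in> \<Omega>"
  shows "(\<Sum>k=1..N - 1. (u k y - u k (p k)) \<bullet> (y - x))
      \<ge> - (2 * real N ^ 2 * M * (\<Sum>k=1..N - 1. norm (p k - x)))"
proof -
  obtain m where m: "N = Suc m" "m \<ge> 1" using N by (cases N) auto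
  define w where "w = (\<lambda>j\<in>{1..N}. if j = N then y else p (N - j))"
  define v where "v = (\<lambda>j\<in>{1..N}. if j = N then y else x)"
  define E where "E = (\<Sum>k=1..N - 1. norm (p k - x))"
  have w: "w \<in> tuples N \<Omega>"
    unfolding w_def
  proof (rule tuples_restrictI)
    fix j assume "j \<in> {1..N}"
    then have "j = N \<or> N - j \<in> {1..N - 1}" by auto
    then show "(if j = N then y else p (N - j)) \<in> \<Omega>" using y p by auto
  qed
  have "norm (u 1 x) \<le> M" using N by (intro M x) auto
  then have M0: "M \<ge> 0" using norm_ge_zero order_trans by blast
  have near: "norm (w j - v j) \<le> E" if j: "j \<in> {1..N}" for j
  proof (cases "j = N")
    case True
    then show ?thesis using j by (auto simp: w_def v_def E_def intro: sum_nonneg)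
  next
    case False
    then have "N - j \<in> {1..N - 1}" using j by auto
    then have "norm (p (N - j) - x) \<le> E" unfolding E_def by (intro member_le_sum) auto
    then show ?thesis using j False by (simp add: w_def v_def)
  qed
  let ?g = "\<lambda>i. \<Sum>l=1..N - 1. u l (w (i + 1)) \<bullet> (v ((l + i) mod N + 1) - v (i + 1))"
  have gap: "?g i - 2 * real N * M * E \<le> field_gap N u ((cyc N ^^ i) w)" if i: "i < N" for i
  proof -
    have "u l (w (i + 1)) \<bullet> (v ((l + i) mod N + 1) - v (i + 1)) - M * (2 * E)
        \<le> u l (w (i + 1)) \<bullet> (w ((l + i) mod N + 1) - w (i + 1))" if l: "l \<in> {1..N - 1}" for l
    proof -
      let ?a = "v ((l + i) mod N + 1) - w ((l + i) mod N + 1)" and ?b = "v (i + 1) - w (i + 1)"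
      have "(l + i) mod N + 1 \<in> {1..N}" using N by (auto simp: Suc_leI)
      then have "norm (?a - ?b) \<le> 2 * E"
        using near[of "(l + i) mod N + 1"] near[of "i + 1"] i norm_triangle_ineq4[of ?a ?b]
        by (simp add: norm_minus_commute)
      moreover have "norm (u l (w (i + 1))) \<le> M" using M[OF l] tuples_D[OF w, of "i + 1"] i by auto
      ultimately have "norm (u l (w (i + 1))) * norm (?a - ?b) \<le> M * (2 * E)"
        using M0 by (intro mult_mono) auto
      then have "u l (w (i + 1)) \<bullet> (?a - ?b) \<le> M * (2 * E)"
        using norm_cauchy_schwarz order_trans by blast
      then show ?thesis by (simp add: inner_diff_right)
    qed
    then have "(\<Sum>l=1..N - 1. u l (w (i + 1)) \<bullet> (v ((l + i) mod N + 1) - v (i + 1)) - M * (2 * E))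
        \<le> field_gap N u ((cyc N ^^ i) w)"
      unfolding field_gap_cyc_pow[OF w i] by (rule sum_mono)
    then have "?g i - real (N - 1) * (M * (2 * E)) \<le> field_gap N u ((cyc N ^^ i) w)"
      by (simp only: sum_subtractf sum_constant card_atLeastAtMost diff_Suc_1 add_diff_cancel_right')
    moreover have "real (N - 1) * (M * (2 * E)) \<le> real N * (M * (2 * E))"
      using M0 by (intro mult_right_mono) (auto simp: E_def intro!: mult_nonneg_nonneg sum_nonneg)
    moreover have "2 * real N * M * E = real N * (M * (2 * E))" by simp
    ultimately show ?thesis by linarith
  qed
  \<comment> \<open>In the rows other than that of \<open>y\<close>, one difference is \<open>y - x\<close> and all others vanish.\<close>
  have x_rows: "?g i = u (m - i) (p (m - i)) \<bullet> (y - x)" if i: "i < m" for i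
  proof -
    have wi: "w (i + 1) = p (m - i)" "v (i + 1) = x" using i m by (auto simp: w_def v_def)
    have "v ((l + i) mod N + 1) - x = (if l = m - i then y - x else 0)" if l: "l \<in> {1..N - 1}" for l
    proof (cases "l = m - i")
      case True
      then have "(l + i) mod N + 1 = N" using i m by simp
      then show ?thesis using True N by (simp add: v_def)
    next
      case False
      have "(l + i) mod N \<noteq> m"
      proof (cases "l + i < N")
        case True
        then show ?thesis using False by simp
      next
        case ge: False
        then have "(l + i) mod N = l + i - N" using l i m by (simp add: mod_if)
        then show ?thesis using l i m by auto
      qed
      moreover have "(l + i) mod N < N" using N by simp
      ultimately show ?thesis using False m by (auto simp: v_def)
    qed
    then have "?g i = (\<Sum>l=1..N - 1. if l = m - i then u l (p (m - i)) \<bullet> (y - x) else 0)"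
      unfolding wi by (intro sum.cong) auto
    also have "\<dots> = u (m - i) (p (m - i)) \<bullet> (y - x)"
      using i m by (subst sum.delta) auto
    finally show ?thesis .
  qed
  have y_row: "?g m = (\<Sum>l=1..N - 1. u l y \<bullet> (x - y))"
  proof (rule sum.cong[OF refl])
    fix l assume l: "l \<in> {1..N - 1}"
    have "(l + m) mod N = (l - 1 + N) mod N" using l m by (intro arg_cong2[of _ _ _ _ "(mod)"]) auto
    also have "\<dots> = l - 1" unfolding mod_add_self2 using l by auto
    finally have "(l + m) mod N + 1 = l" using l by auto
    then show "u l (w (m + 1)) \<bullet> (v ((l + m) mod N + 1) - v (m + 1)) = u l y \<bullet> (x - y)"
      using l m by (auto simp: w_def v_def)
  qed
  have "(\<Sum>i<m. ?g i) = (\<Sum>i<m. u (m - i) (p (m - i)) \<bullet> (y - x))"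
    by (intro sum.cong refl x_rows) simp
  also have "\<dots> = (\<Sum>i<m. u (Suc (m - Suc i)) (p (Suc (m - Suc i))) \<bullet> (y - x))"
    by (intro sum.cong) (auto simp: Suc_diff_Suc)
  also have "\<dots> = (\<Sum>i<m. u (Suc i) (p (Suc i)) \<bullet> (y - x))"
    by (rule sum.nat_diff_reindex)
  also have "\<dots> = (\<Sum>k=1..N - 1. u k (p k) \<bullet> (y - x))"
    unfolding m One_nat_def diff_Suc_Suc diff_zero sum.atLeast1_atMost_eq ..
  finally have "(\<Sum>i<N. ?g i) = (\<Sum>k=1..N - 1. u k (p k) \<bullet> (y - x)) + (\<Sum>l=1..N - 1. u l y \<bullet> (x - y))"
    using y_row by (simp add: m)
  also have "\<dots> = - (\<Sum>k=1..N - 1. (u k y - u k (p k)) \<bullet> (y - x))"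
    by (simp add: sum_negf[symmetric] sum.distrib[symmetric] inner_diff_left inner_diff_right algebra_simps)
  finally have g: "(\<Sum>i<N. ?g i) = - (\<Sum>k=1..N - 1. (u k y - u k (p k)) \<bullet> (y - x))" .
  have "orbit_sum N (field_gap N u) w \<le> 0"
    using mono w N by (simp add: jointly_monotone_iff_sub_antisymmetric sub_antisymmetric_orbit_sum)
  moreover have "(\<Sum>i<N. ?g i - 2 * real N * M * E) \<le> orbit_sum N (field_gap N u) w"
  proof -
    have e: "{0..N - 1} = {..<N}" using N by auto
    show ?thesis unfolding orbit_sum_def e by (intro sum_mono gap) auto
  qed
  ultimately have "(\<Sum>i<N. ?g i) \<le> real N * (2 * real N * M * E)" by (simp add: sum_subtractf)
  then show ?thesis unfolding g by (simp add: E_def power2_eq_square algebra_simps)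
qed

lemma common_bound:
  fixes N :: nat
  assumes "\<forall>l\<in>{1..N - 1}. bounded (u l ` \<Omega>)"
  obtains M where "M \<ge> 0" "\<And>l y. l \<in> {1..N - 1} \<Longrightarrow> y \<in> \<Omega> \<Longrightarrow> norm (u l y) \<le> M"
proof -
  have "bounded (\<Union>l\<in>{1..N - 1}. u l ` \<Omega>)" using assms bounded_UN[of "{1..N - 1}" "\<lambda>l. u l ` \<Omega>"] by auto
  then obtain M where "M > 0" "\<forall>z\<in>(\<Union>l\<in>{1..N - 1}. u l ` \<Omega>). norm z \<le> M"
    unfolding bounded_pos by blast
  then show ?thesis using that[of M] by auto
qed

lemma jointly_monotone_sum_monotone:
  assumes N: "N \<ge> 2" and mono: "jointly_monotone N \<Omega> u"
    and bd: "\<forall>l\<in>{1..N - 1}. bounded (u l ` \<Omega>)"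
  shows "monotone_field \<Omega> (\<lambda>x. \<Sum>l=1..N - 1. u l x)"
  unfolding monotone_field_def
proof (intro ballI)
  fix x y assume xy: "x \<in> \<Omega>" "y \<in> \<Omega>"
  obtain M where "\<And>l y. l \<in> {1..N - 1} \<Longrightarrow> y \<in> \<Omega> \<Longrightarrow> norm (u l y) \<le> M"
    using common_bound[OF bd] by blast
  from two_point_cycle[OF N mono this xy, of "\<lambda>_. x"] xy
  show "((\<Sum>l=1..N - 1. u l y) - (\<Sum>l=1..N - 1. u l x)) \<bullet> (y - x) \<ge> 0"
    by (simp add: inner_sum_left flip: sum_subtractf)
qed

text \<open>
  Move only \<open>p\<^sub>l\<close> from \<open>x\<close> to a nearby \<open>z\<close>, and take \<open>y\<close> at distance \<open>t\<close> from \<open>x\<close> in the direction of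
  \<open>u\<^sub>l(z) - u\<^sub>l(x)\<close>. Then \<open>two_point_cycle\<close> bounds \<open>|u\<^sub>l(z) - u\<^sub>l(x)|\<close> by the variation of the sum between \<open>x\<close> and
  \<open>y\<close> plus \<open>C |z - x| / t\<close>; both are small once first \<open>t\<close> and then \<open>|z - x|\<close> are small.
\<close>

lemma isCont_field_of_isCont_sum:
  fixes u :: "nat \<Rightarrow> 'a::euclidean_space \<Rightarrow> 'a"
  assumes N: "N \<ge> 2" and mono: "jointly_monotone N \<Omega> u" and \<Omega>: "open \<Omega>"
    and bd: "\<forall>l\<in>{1..N - 1}. bounded (u l ` \<Omega>)"
    and x: "x \<in> \<Omega>" and cont: "isCont (\<lambda>x. \<Sum>l=1..N - 1. u l x) x" and l: "l \<in> {1..N - 1}"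
  shows "isCont (u l) x"
  unfolding continuous_at_eps_delta
proof (intro allI impI)
  let ?S = "\<lambda>x. \<Sum>l=1..N - 1. u l x"
  fix \<epsilon> :: real assume \<epsilon>: "\<epsilon> > 0"
  obtain M where M: "M \<ge> 0" "\<And>l y. l \<in> {1..N - 1} \<Longrightarrow> y \<in> \<Omega> \<Longrightarrow> norm (u l y) \<le> M"
    using common_bound[OF bd] by blast
  define C where "C = 2 * real N ^ 2 * M + 1"
  have C: "C > 0" using M(1) by (simp add: C_def add_nonneg_pos)
  obtain r where r: "r > 0" "ball x r \<subseteq> \<Omega>" using \<Omega> x openE by blast
  obtain d where d: "d > 0" "\<And>y. dist y x < d \<Longrightarrow> dist (?S y) (?S x) < \<epsilon> / 2"
    using cont \<epsilon> unfolding continuous_at_eps_delta by (meson half_gt_zero)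
  define t where "t = min d r / 2"
  have t: "t > 0" "t < d" "t < r" using d(1) r(1) by (auto simp: t_def)
  define \<delta> where "\<delta> = min r (\<epsilon> * t / (2 * C))"
  have "\<delta> > 0" using r(1) \<epsilon> t(1) C by (simp add: \<delta>_def)
  moreover have "dist (u l z) (u l x) < \<epsilon>" if z: "dist z x < \<delta>" for z
  proof -
    have z\<Omega>: "z \<in> \<Omega>" using z by (auto intro!: subsetD[OF r(2)] simp: \<delta>_def dist_commute)
    let ?D = "u l z - u l x"
    define y where "y = x + t *\<^sub>R sgn ?D"
    have yx: "norm (y - x) \<le> t" using t(1) by (simp add: y_def norm_sgn)
    then have y\<Omega>: "y \<in> \<Omega>" using t(3) by (auto intro!: subsetD[OF r(2)] simp: dist_norm norm_minus_commute)
    let ?p = "\<lambda>k. if k = l then z else x"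
    have "(\<Sum>k=1..N - 1. norm (?p k - x)) = (\<Sum>k=1..N - 1. if k = l then norm (z - x) else 0)"
      by (intro sum.cong) auto
    also have "\<dots> = norm (z - x)" using l by (subst sum.delta) auto
    finally have E: "(\<Sum>k=1..N - 1. norm (?p k - x)) = norm (z - x)" .
    have "(\<Sum>k=1..N - 1. (u k y - u k (?p k)) \<bullet> (y - x))
        = (\<Sum>k=1..N - 1. (u k y - u k x) \<bullet> (y - x) - (if k = l then ?D \<bullet> (y - x) else 0))"
      by (intro sum.cong) (auto simp: inner_diff_left)
    also have "\<dots> = (?S y - ?S x) \<bullet> (y - x) - ?D \<bullet> (y - x)"
      using l by (simp add: sum_subtractf sum.delta inner_sum_left inner_diff_left)
    finally have "- (2 * real N ^ 2 * M * norm (z - x)) \<le> (?S y - ?S x) \<bullet> (y - x) - ?D \<bullet> (y - x)"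
      using two_point_cycle[OF N mono M(2) x y\<Omega>, of ?p] x z\<Omega> unfolding E by simp
    moreover have "?D \<bullet> (y - x) = t * norm ?D"
      by (cases "?D = 0") (simp_all add: y_def sgn_div_norm dot_square_norm power2_eq_square)
    moreover have "(?S y - ?S x) \<bullet> (y - x) \<le> (\<epsilon> / 2) * t"
    proof -
      have "(?S y - ?S x) \<bullet> (y - x) \<le> norm (?S y - ?S x) * norm (y - x)" by (rule norm_cauchy_schwarz)
      also have "\<dots> \<le> (\<epsilon> / 2) * t"
        using d(2)[of y] yx t \<epsilon> by (intro mult_mono) (auto simp: dist_norm)
      finally show ?thesis .
    qed
    moreover have "2 * real N ^ 2 * M * norm (z - x) < (\<epsilon> / 2) * t"
    proof -
      have "2 * real N ^ 2 * M * norm (z - x) \<le> C * norm (z - x)"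
        by (intro mult_right_mono) (auto simp: C_def)
      also have "\<dots> < C * (\<epsilon> * t / (2 * C))"
        using z C by (intro mult_strict_left_mono) (auto simp: \<delta>_def dist_norm)
      finally show ?thesis using C by (simp add: field_simps)
    qed
    ultimately have "t * norm ?D < t * \<epsilon>" by (simp add: algebra_simps)
    then show ?thesis using t(1) by (simp add: dist_norm)
  qed
  ultimately show "\<exists>d>0. \<forall>z. dist z x < d \<longrightarrow> dist (u l z) (u l x) < \<epsilon>" by blast
qed

lemma jointly_monotone_AE_isCont:
  fixes u :: "nat \<Rightarrow> 'a::euclidean_space \<Rightarrow> 'a"
  assumes N: "N \<ge> 2" and mono: "jointly_monotone N \<Omega> u" and \<Omega>: "open \<Omega>"
    and bd: "\<forall>l\<in>{1..N - 1}. bounded (u l ` \<Omega>)"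
  shows "AE x in lebesgue. x \<in> \<Omega> \<longrightarrow> (\<forall>l\<in>{1..N - 1}. isCont (u l) x)"
proof -
  let ?S = "\<lambda>x. \<Sum>l=1..N - 1. u l x"
  obtain M where M: "M \<ge> 0" "\<And>l y. l \<in> {1..N - 1} \<Longrightarrow> y \<in> \<Omega> \<Longrightarrow> norm (u l y) \<le> M"
    using common_bound[OF bd] by blast
  have "bounded (?S ` \<Omega>)"
    unfolding bounded_iff
  proof (intro exI ballI)
    fix z assume "z \<in> ?S ` \<Omega>"
    then obtain y where y: "y \<in> \<Omega>" "z = ?S y" by blast
    show "norm z \<le> (\<Sum>l=1..N - 1. M)"
      unfolding y(2) by (intro sum_norm_le M y)
  qed
  then have "AE x in lborel. x \<in> \<Omega> \<longrightarrow> isCont ?S x"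
    by (intro monotone_field_AE_isCont[OF \<Omega> jointly_monotone_sum_monotone[OF N mono bd]])
  then have "AE x in lborel. x \<in> \<Omega> \<longrightarrow> (\<forall>l\<in>{1..N - 1}. isCont (u l) x)"
    by eventually_elim (use isCont_field_of_isCont_sum[OF N mono \<Omega> bd] in blast)
  then show ?thesis by (rule AE_completion)
qed

section \<open>Gradients on the diagonal\<close>

lemma prepend_upd_first:
  assumes "N \<ge> 1" "w \<in> tuples N S"
  shows "prepend N a (\<lambda>i\<in>{1..N - 1}. w (i + 1)) = w(1 := a)"
proof -
  have "w(1 := a) \<in> tuples N UNIV"
    using assms by (intro tuples_fun_upd) (auto simp: tuples_def PiE_iff)
  from prepend_first_rest[OF assms(1) this]
  have "prepend N ((w(1 := a)) 1) (\<lambda>i\<in>{1..N - 1}. (w(1 := a)) (i + 1)) = w(1 := a)" .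
  moreover have "(\<lambda>i\<in>{1..N - 1}. (w(1 := a)) (i + 1)) = (\<lambda>i\<in>{1..N - 1}. w (i + 1))"
    by (rule restrict_ext) simp
  ultimately show ?thesis by (simp only: fun_upd_same)
qed

lemma tendsto_coordinate: "((\<lambda>z::nat \<Rightarrow> 'a::topological_space. z i) \<longlongrightarrow> d i) (at d within T)"
  using continuous_on_product_coordinates[of i, where 'b = 'a] by (simp add: continuous_on_def tendsto_within_subset[of _ _ d UNIV T])

text \<open>
  The gradient of a convex function is a subgradient. The difference quotient along the segment from
  the diagonal point \<open>d\<close> to \<open>y\<close> tends to the one given by the gradient, and convexity keeps it below
  its value at the end point of the segment.
\<close>

lemma diagonal_gradient_imp_field_gap_le:
  fixes \<Omega> :: "'a::euclidean_space set"
  assumes N: "N \<ge> 2" and conv: "convex \<Omega>" and H: "convex_in_others N \<Omega> H"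
    and zero: "zero_on_diagonal N \<Omega> H" and w: "w \<in> tuples N \<Omega>"
    and grad: "diagonal_gradient_at N \<Omega> H u (w 1)"
  shows "field_gap N u w \<le> H w"
proof -
  define m where "m = N - 1"
  define x where "x = w 1"
  define d where "d = diag m x"
  define y where "y = (\<lambda>i\<in>{1..m}. w (i + 1))"
  define G where "G = (\<Sum>i=1..m. u i x \<bullet> (y i - d i))"
  define L where "L = L2_set (\<lambda>i. norm (y i - d i)) {1..m}"
  let ?F = "\<lambda>z. H (prepend N x z)"
  have N1: "N \<ge> 1" using N by simp
  have x: "x \<in> \<Omega>" using tuples_D[OF w] N by (simp add: x_def)
  have y: "y \<in> tuples m \<Omega>" using rest_in_tuples[OF w] by (simp add: y_def m_def)
  have d: "d \<in> tuples m \<Omega>" by (simp add: d_def diag_in_tuples x)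
  have Fd: "?F d = 0" using zero x prepend_diag[of N x] by (simp add: d_def m_def zero_on_diagonal_def)
  have Fy: "?F y = H w" using prepend_first_rest[OF N1 w] by (simp add: x_def y_def m_def)
  have gap: "field_gap N u w = G"
    by (simp add: field_gap_def G_def y_def d_def diag_def m_def x_def)
  show ?thesis
  proof (cases "y = d")
    case True
    then show ?thesis using Fd Fy gap by (simp add: G_def)
  next
    case False
    then obtain i where i: "i \<in> {1..m}" "y i \<noteq> d i" using tuples_eqI[OF y d] by blast
    have "L \<noteq> 0" unfolding L_def by (subst L2_set_eq_0_iff) (use i in auto)
    then have L: "L > 0" unfolding L_def using L2_set_nonneg less_eq_real_def by metis
    define q where "q z = (?F z - ?F d - (\<Sum>i=1..m. u i x \<bullet> (z i - d i)))
        / L2_set (\<lambda>i. norm (z i - d i)) {1..m}" for z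
    have q: "(q \<longlongrightarrow> 0) (at d within tuples m \<Omega>)"
      using grad unfolding diagonal_gradient_at_def has_tuple_gradient_def q_def m_def d_def x_def .
    let ?z = "\<lambda>t::real. mix m (1 - t) d t y"
    have zi: "?z t i - d i = t *\<^sub>R (y i - d i)" if "i \<in> {1..m}" for t i
      using that by (simp add: mix_def algebra_simps)
    have small: "\<forall>\<^sub>F t in at_right 0. 0 < t \<and> t < (1::real)"
      by (intro eventually_conj eventually_at_right_less) (auto simp: eventually_at_right_field intro: exI[of _ 1])
    have "filterlim ?z (at d within tuples m \<Omega>) (at_right 0)"
      unfolding filterlim_at
    proof
      show "\<forall>\<^sub>F t in at_right 0. ?z t \<in> tuples m \<Omega> \<and> ?z t \<noteq> d"
        using small
      proof eventually_elim
        case (elim t)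
        then have "?z t i \<noteq> d i" using zi[OF i(1), of t] i(2) by auto
        then show ?case using mix_in_tuples[OF conv d y, of "1 - t" t] elim by auto
      qed
      have "continuous_on UNIV ?z"
      proof (rule continuous_on_coordinatewise_then_product)
        fix i show "continuous_on UNIV (\<lambda>t. ?z t i)"
        proof (cases "i \<in> {1..m}")
          case True
          then show ?thesis by (simp add: mix_def continuous_intros)
        next
          case False
          then have "?z t i = undefined" for t
            unfolding mix_def by (simp only: restrict_apply if_False)
          then show ?thesis by simp
        qed
      qed
      then have "(?z \<longlongrightarrow> ?z 0) (at_right 0)"
        unfolding continuous_on_def using tendsto_within_subset by blast
      moreover have "?z 0 = d"
        using tuples_eqI[OF mix_in_tuples[OF conv d y] d, of 1 0] by (simp add: mix_def)
      ultimately show "(?z \<longlongrightarrow> d) (at_right 0)" by simp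
    qed
    from filterlim_compose[OF q this] have "((\<lambda>t. q (?z t)) \<longlongrightarrow> 0) (at_right 0)" .
    moreover have "\<forall>\<^sub>F t in at_right 0. q (?z t) \<le> (H w - G) / L"
      using small
    proof eventually_elim
      case (elim t)
      have 1: "prepend N x (?z t) = mix N (1 - t) (prepend N x d) t (prepend N x y)"
      proof -
        have "(1 - t) *\<^sub>R x + t *\<^sub>R x = x" by (simp flip: scaleR_left_distrib)
        then show ?thesis by (auto simp: prepend_def mix_def m_def fun_eq_iff)
      qed
      have "?F (?z t) \<le> (1 - t) * ?F d + t * ?F y"
        unfolding 1
        using elim N convex_in_othersD[OF H N1 prepend_in_tuples[OF x d[unfolded m_def]]
            prepend_in_tuples[OF x y[unfolded m_def]], of "1 - t" t]
        by (simp add: prepend_def)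
      then have F_le: "?F (?z t) \<le> t * H w" using Fd Fy by simp
      have lin: "(\<Sum>i=1..m. u i x \<bullet> (?z t i - d i)) = t * G"
        unfolding G_def sum_distrib_left by (intro sum.cong) (auto simp: zi)
      have dist: "L2_set (\<lambda>i. norm (?z t i - d i)) {1..m} = t * L"
        unfolding L_def using elim by (subst L2_set_right_distrib) (auto simp: zi intro!: L2_set_cong)
      have "q (?z t) \<le> (t * H w - t * G) / (t * L)"
        unfolding q_def Fd lin dist using F_le elim L by (intro divide_right_mono) auto
      also have "\<dots> = (H w - G) / L" using elim by (simp add: right_diff_distrib[symmetric])
      finally show ?case .
    qed
    ultimately have "0 \<le> (H w - G) / L" by (rule tendsto_upperbound) simp
    then show ?thesis using L gap by (simp add: zero_le_divide_iff)
  qed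
qed

lemma rotated_sum_mono:
  assumes "w \<in> tuples N \<Omega>" "\<And>w. w \<in> tuples N \<Omega> \<Longrightarrow> F w \<le> H w"
  shows "rotated_sum N F w \<le> rotated_sum N H w"
  using assms by (intro sum_mono) (auto intro: cyc_pow_in_tuples)

text \<open>
  Sub-antisymmetry bounds \<open>H\<close> from above by minus the other rotations of the gap functional, so \<open>H\<close> exceeds
  the gap functional by at most minus its orbit sum. Subtracting the vanishing orbit sum for the fields
  frozen at \<open>x\<close> exhibits in that bound the factors \<open>u\<^sub>l(w\<^sub>i) - u\<^sub>l(x)\<close>, which tend to zero.
\<close>

lemma diagonal_gradient_at_isCont:
  fixes \<Omega> :: "'a::euclidean_space set"
  assumes N: "N \<ge> 2" and anti: "sub_antisymmetric N \<Omega> H" and zero: "zero_on_diagonal N \<Omega> H"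
    and gap_le: "\<And>w. w \<in> tuples N \<Omega> \<Longrightarrow> field_gap N u w \<le> H w"
    and x: "x \<in> \<Omega>" and cont: "\<And>l. l \<in> {1..N - 1} \<Longrightarrow> isCont (u l) x"
  shows "diagonal_gradient_at N \<Omega> H u x"
proof -
  define m where "m = N - 1"
  define d where "d = diag m x"
  let ?w = "\<lambda>z. prepend N x z"
  let ?L = "\<lambda>z. L2_set (\<lambda>i. norm (z i - d i)) {1..m}"
  define q where "q z = (H (?w z) - H (?w d) - (\<Sum>i=1..m. u i x \<bullet> (z i - d i))) / ?L z" for z
  define R where "R z = (\<Sum>i<N. \<Sum>l=1..m. norm (u l (?w z (i + 1)) - u l x) * 2)" for z
  have N1: "N \<ge> 1" and e: "{0..N - 1} = {..<N}" using N by auto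
  have Fd: "H (?w d) = 0" using zero x prepend_diag[of N x] by (simp add: d_def m_def zero_on_diagonal_def)
  have bounds: "0 \<le> q z \<and> q z \<le> R z" if z: "z \<in> tuples m \<Omega>" "z \<noteq> d" for z
  proof -
    have w: "?w z \<in> tuples N \<Omega>" using prepend_in_tuples x z by (simp add: m_def)
    have "(\<Sum>i=1..m. u i x \<bullet> (z i - d i)) = field_gap N u (?w z)"
      unfolding field_gap_def m_def[symmetric] using N
      by (intro sum.cong) (auto simp: prepend_def d_def diag_def m_def)
    then have q: "q z = (H (?w z) - field_gap N u (?w z)) / ?L z" unfolding q_def Fd by simp
    obtain j where j: "j \<in> {1..m}" "z j \<noteq> d j"
      using tuples_eqI[OF z(1), of d \<Omega>] z(2) diag_in_tuples[OF x] by (auto simp: d_def)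
    have "?L z \<noteq> 0" by (subst L2_set_eq_0_iff) (use j in auto)
    then have L: "?L z > 0" using L2_set_nonneg less_eq_real_def by metis
    have near: "norm (?w z j - x) \<le> ?L z" if j: "j \<in> {1..N}" for j
    proof (cases "j = 1")
      case True
      then show ?thesis using j by (simp add: prepend_def)
    next
      case False
      then have "j - 1 \<in> {1..m}" using j by (auto simp: m_def)
      then have "norm (z (j - 1) - d (j - 1)) \<le> ?L z" by (intro member_le_L2_set) auto
      then show ?thesis using False j \<open>j - 1 \<in> {1..m}\<close> by (simp add: prepend_def d_def diag_def)
    qed
    have "H (?w z) - field_gap N u (?w z) \<le> - orbit_sum N (field_gap N u) (?w z)"
    proof -
      have "orbit_sum N H (?w z) \<le> 0" using anti w by (simp add: sub_antisymmetric_orbit_sum)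
      then show ?thesis
        using rotated_sum_mono[OF w, of "field_gap N u" H, OF gap_le] unfolding orbit_sum_split by linarith
    qed
    also have "\<dots> = orbit_sum N (field_gap N (\<lambda>l _. u l x)) (?w z) - orbit_sum N (field_gap N u) (?w z)"
      using orbit_sum_field_gap_const[OF w N1, of "\<lambda>l. u l x"] by simp
    also have "\<dots> = (\<Sum>i<N. \<Sum>l=1..m. (u l x - u l (?w z (i + 1)))
          \<bullet> (?w z ((l + i) mod N + 1) - ?w z (i + 1)))"
      unfolding orbit_sum_def e sum_subtractf[symmetric] m_def
      by (intro sum.cong refl)
         (simp add: field_gap_cyc_pow[OF w] inner_diff_left flip: sum_subtractf)
    also have "\<dots> \<le> (\<Sum>i<N. \<Sum>l=1..m. norm (u l (?w z (i + 1)) - u l x) * 2 * ?L z)"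
    proof (intro sum_mono)
      fix i l assume i: "i \<in> {..<N}" and l: "l \<in> {1..m}"
      let ?a = "?w z ((l + i) mod N + 1) - x" and ?b = "?w z (i + 1) - x"
      have "(l + i) mod N + 1 \<in> {1..N}" using N by (auto simp: Suc_leI)
      then have "norm (?a - ?b) \<le> 2 * ?L z"
        using near[of "(l + i) mod N + 1"] near[of "i + 1"] i norm_triangle_ineq4[of ?a ?b] by simp
      then have "norm (u l x - u l (?w z (i + 1))) * norm (?a - ?b)
          \<le> norm (u l x - u l (?w z (i + 1))) * (2 * ?L z)"
        by (intro mult_left_mono) auto
      then have "(u l x - u l (?w z (i + 1))) \<bullet> (?a - ?b)
          \<le> norm (u l x - u l (?w z (i + 1))) * (2 * ?L z)"
        using norm_cauchy_schwarz order_trans by blast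
      then show "(u l x - u l (?w z (i + 1))) \<bullet> (?w z ((l + i) mod N + 1) - ?w z (i + 1))
          \<le> norm (u l (?w z (i + 1)) - u l x) * 2 * ?L z"
        by (simp add: norm_minus_commute mult.assoc)
    qed
    also have "\<dots> = R z * ?L z" by (simp add: R_def sum_distrib_right)
    finally have "H (?w z) - field_gap N u (?w z) \<le> R z * ?L z" .
    then show ?thesis unfolding q using L gap_le[OF w] by (simp add: divide_le_eq)
  qed
  have "(R \<longlongrightarrow> 0) (at d within tuples m \<Omega>)"
    unfolding R_def
  proof (intro tendsto_null_sum)
    fix i l assume i: "i \<in> {..<N}" and l: "l \<in> {1..m}"
    have "((\<lambda>z. ?w z (i + 1)) \<longlongrightarrow> x) (at d within tuples m \<Omega>)"
    proof (cases "i = 0")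
      case True
      then show ?thesis using N by (simp add: prepend_def)
    next
      case False
      then have "i \<in> {1..m}" using i by (auto simp: m_def)
      then have "d i = x" by (simp add: d_def diag_def)
      then show ?thesis using tendsto_coordinate[of i d "tuples m \<Omega>"] False i by (simp add: prepend_def)
    qed
    then have "((\<lambda>z. u l (?w z (i + 1))) \<longlongrightarrow> u l x) (at d within tuples m \<Omega>)"
      using isCont_tendsto_compose[OF cont] l by (simp add: m_def)
    then have "((\<lambda>z. norm (u l (?w z (i + 1)) - u l x) * 2) \<longlongrightarrow> norm (u l x - u l x) * 2)
        (at d within tuples m \<Omega>)"
      by (intro tendsto_intros)
    then show "((\<lambda>z. norm (u l (?w z (i + 1)) - u l x) * 2) \<longlongrightarrow> 0) (at d within tuples m \<Omega>)"
      by simp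
  qed
  then have "(q \<longlongrightarrow> 0) (at d within tuples m \<Omega>)"
    by (rule tendsto_sandwich[rotated 3, of _ _ _ "\<lambda>_. 0"])
       (auto simp: eventually_at_filter bounds intro!: always_eventually)
  then show ?thesis
    unfolding diagonal_gradient_at_def has_tuple_gradient_def q_def d_def m_def .
qed

section \<open>Continuity of the Hamiltonian and antisymmetrization\<close>

text \<open>
  Extend the segment from \<open>a\<close> to \<open>x\<close> to the points \<open>p\<close> and \<open>q\<close> of the sphere on either side of \<open>a\<close>. Convexity on
  \<open>[a, p]\<close> bounds the increase from \<open>a\<close> to \<open>x\<close>, convexity on \<open>[q, x]\<close> bounds the decrease.
\<close>

lemma convex_on_lipschitz_at_centre:
  fixes g :: "'a::real_normed_vector \<Rightarrow> real"
  assumes g: "convex_on S g" and S: "cball a r \<subseteq> S" and r: "r > 0"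
    and B: "\<And>z. z \<in> cball a r \<Longrightarrow> \<bar>g z\<bar> \<le> B" and x: "x \<in> cball a r"
  shows "\<bar>g x - g a\<bar> \<le> 2 * B / r * norm (x - a)"
proof (cases "x = a")
  case False
  define \<theta> where "\<theta> = norm (x - a) / r"
  have \<theta>: "0 < \<theta>" "\<theta> \<le> 1" using False r x by (auto simp: \<theta>_def dist_norm norm_minus_commute)
  define p where "p = a + (1 / \<theta>) *\<^sub>R (x - a)"
  define q where "q = a - (1 / \<theta>) *\<^sub>R (x - a)"
  have "norm ((1 / \<theta>) *\<^sub>R (x - a)) = r" using False r by (simp add: \<theta>_def)
  then have pq: "p \<in> cball a r" "q \<in> cball a r" by (auto simp: p_def q_def dist_norm)
  have a: "a \<in> cball a r" using r by simp
  have inS: "a \<in> S" "x \<in> S" "p \<in> S" "q \<in> S" using S a x pq by blast+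
  have "x = (1 - \<theta>) *\<^sub>R a + \<theta> *\<^sub>R p" using \<theta> by (simp add: p_def algebra_simps)
  then have "g x \<le> (1 - \<theta>) * g a + \<theta> * g p"
    using convex_onD[OF g, of \<theta> a p] \<theta> inS by simp
  then have up: "g x - g a \<le> \<theta> * (g p - g a)" by (simp add: algebra_simps)
  define \<beta> where "\<beta> = \<theta> / (1 + \<theta>)"
  have \<beta>: "0 \<le> \<beta>" "\<beta> \<le> 1" "(1 + \<theta>) * \<beta> = \<theta>" "(1 + \<theta>) * (1 - \<beta>) = 1"
    using \<theta> by (auto simp: \<beta>_def field_simps)
  have "(1 + \<theta>) *\<^sub>R ((1 - \<beta>) *\<^sub>R x + \<beta> *\<^sub>R q) = x + \<theta> *\<^sub>R q"
    unfolding scaleR_add_right scaleR_scaleR \<beta> by simp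
  also have "\<dots> = (1 + \<theta>) *\<^sub>R a" using \<theta> by (simp add: q_def algebra_simps)
  finally have "(1 - \<beta>) *\<^sub>R x + \<beta> *\<^sub>R q = a" using \<theta> by simp
  with convex_onD[OF g \<beta>(1,2) inS(2,4)] have "g a \<le> (1 - \<beta>) * g x + \<beta> * g q" by simp
  then have "(1 + \<theta>) * g a \<le> (1 + \<theta>) * ((1 - \<beta>) * g x + \<beta> * g q)"
    using \<theta> by (intro mult_left_mono) auto
  also have "\<dots> = ((1 + \<theta>) * (1 - \<beta>)) * g x + ((1 + \<theta>) * \<beta>) * g q"
    by (simp only: distrib_left mult.assoc)
  finally have lo: "g a - g x \<le> \<theta> * (g q - g a)" unfolding \<beta> by (simp add: algebra_simps)
  have "\<theta> * (g p - g a) \<le> \<theta> * (2 * B)" "\<theta> * (g q - g a) \<le> \<theta> * (2 * B)"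
    using B[OF pq(1)] B[OF pq(2)] B[OF a] \<theta> by (intro mult_left_mono; linarith)+
  moreover have "\<theta> * (2 * B) = 2 * B / r * norm (x - a)" by (simp add: \<theta>_def)
  ultimately show ?thesis using up lo by linarith
qed simp

lemma convex_on_coordinate:
  assumes conv: "convex \<Omega>" and H: "convex_in_others N \<Omega> H" and w: "w \<in> tuples N \<Omega>"
    and j: "j \<in> {2..N}"
  shows "convex_on \<Omega> (\<lambda>c. H (w(j := c)))"
proof (rule convex_onI[OF _ conv])
  fix t a b assume t: "0 < t" "t < (1::real)" and ab: "a \<in> \<Omega>" "b \<in> \<Omega>"
  have jN: "j \<in> {1..N}" using j by auto
  have "w(j := (1 - t) *\<^sub>R a + t *\<^sub>R b) = mix N (1 - t) (w(j := a)) t (w(j := b))"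
  proof (rule tuples_eqI[OF tuples_fun_upd[OF w jN] mix_in_tuples[OF conv tuples_fun_upd[OF w jN ab(1)] tuples_fun_upd[OF w jN ab(2)]]])
    show "(1 - t) *\<^sub>R a + t *\<^sub>R b \<in> \<Omega>" using convexD[OF conv ab, of "1 - t" t] t by simp
    fix i assume "i \<in> {1..N}"
    moreover have "(1 - t) *\<^sub>R w i + t *\<^sub>R w i = w i" by (simp flip: scaleR_left_distrib)
    ultimately show "(w(j := (1 - t) *\<^sub>R a + t *\<^sub>R b)) i = mix N (1 - t) (w(j := a)) t (w(j := b)) i"
      by (simp add: mix_def)
  qed (use t in auto)
  then show "H (w(j := (1 - t) *\<^sub>R a + t *\<^sub>R b)) \<le> (1 - t) * H (w(j := a)) + t * H (w(j := b))"
    using convex_in_othersD[OF H _ tuples_fun_upd[OF w jN ab(1)] tuples_fun_upd[OF w jN ab(2)], of "1 - t" t] t j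
    by auto
qed

lemma concave_on_first_coordinate:
  assumes H: "concave_in_first N \<Omega> H" and N: "N \<ge> 1" and w: "w \<in> tuples N \<Omega>"
  shows "concave_on \<Omega> (\<lambda>c. H (w(1 := c)))"
  using H rest_in_tuples[OF w] unfolding concave_in_first_def prepend_upd_first[OF N w, symmetric] by blast

text \<open>
  Pass from \<open>a\<close> to \<open>w\<close> by exchanging one entry at a time: the hybrid \<open>h k\<close> has the first \<open>k\<close> entries from
  \<open>w\<close>. Each exchange changes a single coordinate, in which \<open>H\<close> is convex or concave, and the local bound
  makes the Lipschitz constant the same for all hybrids.
\<close>

lemma continuous_on_tuples:
  fixes \<Omega> :: "'a::euclidean_space set"
  assumes N: "N \<ge> 1" and \<Omega>: "open \<Omega>" "convex \<Omega>"
    and H: "concave_in_first N \<Omega> H" "convex_in_others N \<Omega> H"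
    and bound: "\<And>R. \<exists>B. \<forall>w\<in>tuples N \<Omega>. (\<forall>j\<in>{1..N}. norm (w j) \<le> R) \<longrightarrow> \<bar>H w\<bar> \<le> B"
  shows "continuous_on (tuples N \<Omega>) H"
  unfolding continuous_on_def
proof
  fix a assume a: "a \<in> tuples N \<Omega>"
  have "\<exists>r>0. \<forall>j\<in>{1..N}. cball (a j) r \<subseteq> \<Omega>"
  proof -
    have "\<forall>\<^sub>F r in at_right (0::real). \<forall>j\<in>{1..N}. cball (a j) r \<subseteq> \<Omega>"
    proof (intro eventually_ball_finite ballI)
      fix j assume "j \<in> {1..N}"
      then obtain e where e: "e > 0" "cball (a j) e \<subseteq> \<Omega>"
        using tuples_D[OF a] \<Omega>(1) open_contains_cball by blast
      then have "cball (a j) r \<subseteq> \<Omega>" if "r < e" for r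
        using subset_cball[of r e "a j"] that by auto
      with e(1) show "\<forall>\<^sub>F r in at_right 0. cball (a j) r \<subseteq> \<Omega>"
        by (auto simp: eventually_at_right_field)
    qed simp
    then have "\<forall>\<^sub>F r in at_right (0::real). 0 < r \<and> (\<forall>j\<in>{1..N}. cball (a j) r \<subseteq> \<Omega>)"
      by (intro eventually_conj eventually_at_right_less)
    then show ?thesis using eventually_happens' trivial_limit_at_right_real by blast
  qed
  then obtain r where r: "r > 0" "\<And>j. j \<in> {1..N} \<Longrightarrow> cball (a j) r \<subseteq> \<Omega>" by blast
  obtain B where B: "\<And>w. w \<in> tuples N \<Omega> \<Longrightarrow> (\<forall>j\<in>{1..N}. norm (w j) \<le> (\<Sum>i=1..N. norm (a i)) + r) \<Longrightarrow> \<bar>H w\<bar> \<le> B"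
    using bound by blast
  have B': "\<bar>H w\<bar> \<le> B" if "w \<in> tuples N \<Omega>" "\<And>j. j \<in> {1..N} \<Longrightarrow> w j \<in> cball (a j) r" for w
  proof (rule B[OF that(1)], intro ballI)
    fix j assume j: "j \<in> {1..N}"
    have "norm (w j) \<le> norm (a j) + norm (w j - a j)" by (rule norm_triangle_sub)
    moreover have "norm (a j) \<le> (\<Sum>i=1..N. norm (a i))"
      using j by (intro member_le_sum[of _ _ "\<lambda>i. norm (a i)"]) auto
    ultimately show "norm (w j) \<le> (\<Sum>i=1..N. norm (a i)) + r"
      using that(2)[OF j] by (simp add: dist_norm norm_minus_commute)
  qed
  have lip: "\<bar>H w - H a\<bar> \<le> (\<Sum>k<N. 2 * B / r * norm (w (Suc k) - a (Suc k)))"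
    if w: "w \<in> tuples N \<Omega>" "\<And>j. j \<in> {1..N} \<Longrightarrow> w j \<in> cball (a j) r" for w
  proof -
    define h where "h k = (\<lambda>i\<in>{1..N}. if i \<le> k then w i else a i)" for k
    have h: "h k \<in> tuples N \<Omega>" for k
      unfolding h_def by (rule tuples_restrictI) (use tuples_D[OF w(1)] tuples_D[OF a] in auto)
    have h_near: "h k j \<in> cball (a j) r" if "j \<in> {1..N}" for j k
      using w(2)[OF that] that r(1) by (auto simp: h_def)
    have step: "\<bar>H (h (Suc k)) - H (h k)\<bar> \<le> 2 * B / r * norm (w (Suc k) - a (Suc k))"
      if k: "k < N" for k
    proof -
      let ?j = "Suc k" and ?g = "\<lambda>c. H ((h k)(Suc k := c))"
      have j: "?j \<in> {1..N}" using k by auto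
      have h0: "(h k)(?j := a ?j) = h k" and h1: "(h k)(?j := w ?j) = h ?j"
        using j by (auto simp: h_def fun_eq_iff)
      have bd: "\<bar>?g c\<bar> \<le> B" if c: "c \<in> cball (a ?j) r" for c
        by (rule B'[OF tuples_fun_upd[OF h j subsetD[OF r(2)[OF j] c]]]) (use c h_near in auto)
      show ?thesis
      proof (cases "k = 0")
        case True
        have "convex_on \<Omega> (\<lambda>c. - ?g c)"
          using concave_on_first_coordinate[OF H(1) N h[of 0]] True by (simp add: concave_on_def)
        then have "\<bar>- ?g (w ?j) - - ?g (a ?j)\<bar> \<le> 2 * B / r * norm (w ?j - a ?j)"
          by (rule convex_on_lipschitz_at_centre[OF _ r(2)[OF j] r(1)]) (use bd w(2)[OF j] in auto)
        then show ?thesis unfolding h0 h1 by linarith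
      next
        case False
        then have "convex_on \<Omega> ?g" using convex_on_coordinate[OF \<Omega>(2) H(2) h, of ?j] j by auto
        then have "\<bar>?g (w ?j) - ?g (a ?j)\<bar> \<le> 2 * B / r * norm (w ?j - a ?j)"
          by (rule convex_on_lipschitz_at_centre[OF _ r(2)[OF j] r(1)]) (use bd w(2)[OF j] in auto)
        then show ?thesis unfolding h0 h1 .
      qed
    qed
    have ends: "h 0 = a" "h N = w"
      by (rule tuples_eqI[OF h a], simp add: h_def, rule tuples_eqI[OF h w(1)], simp add: h_def)
    have "H w - H a = (\<Sum>k<N. H (h (Suc k)) - H (h k))"
      using sum_lessThan_telescope[of "\<lambda>k. H (h k)" N] ends by simp
    also have "\<bar>\<dots>\<bar> \<le> (\<Sum>k<N. \<bar>H (h (Suc k)) - H (h k)\<bar>)" by (rule sum_abs)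
    also have "\<dots> \<le> (\<Sum>k<N. 2 * B / r * norm (w (Suc k) - a (Suc k)))"
      by (intro sum_mono step) simp
    finally show ?thesis .
  qed
  let ?F = "at a within tuples N \<Omega>"
  have co: "((\<lambda>w. w j) \<longlongrightarrow> a j) ?F" for j by (rule tendsto_coordinate)
  have "\<forall>\<^sub>F w in ?F. w j \<in> cball (a j) r" for j
    using tendstoD[OF co r(1), of j] by eventually_elim (simp add: dist_commute)
  then have "\<forall>\<^sub>F w in ?F. \<forall>j\<in>{1..N}. w j \<in> cball (a j) r"
    by (intro eventually_ball_finite) auto
  moreover have "\<forall>\<^sub>F w in ?F. w \<in> tuples N \<Omega>" by (simp add: eventually_at_filter)
  ultimately have le: "\<forall>\<^sub>F w in ?F. norm (H w - H a) \<le> (\<Sum>k<N. 2 * B / r * norm (w (Suc k) - a (Suc k)))"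
    by eventually_elim (use lip in auto)
  have "((\<lambda>w. \<Sum>k<N. 2 * B / r * norm (w (Suc k) - a (Suc k))) \<longlongrightarrow>
      (\<Sum>k<N. 2 * B / r * norm (a (Suc k) - a (Suc k)))) ?F"
    by (intro tendsto_intros co)
  then have "((\<lambda>w. \<Sum>k<N. 2 * B / r * norm (w (Suc k) - a (Suc k))) \<longlongrightarrow> 0) ?F" by simp
  with le have "((\<lambda>w. H w - H a) \<longlongrightarrow> 0) ?F" by (rule Lim_null_comparison)
  then show "(H \<longlongrightarrow> H a) ?F" by (rule LIM_zero_cancel)
qed

lemma field_gap_bound:
  assumes M: "M \<ge> 0" "\<And>l y. l \<in> {1..N - 1} \<Longrightarrow> y \<in> \<Omega> \<Longrightarrow> norm (u l y) \<le> M"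
    and N: "N \<ge> 1" and w: "w \<in> tuples N \<Omega>" and R: "\<And>j. j \<in> {1..N} \<Longrightarrow> norm (w j) \<le> R"
  shows "\<bar>field_gap N u w\<bar> \<le> real N * (M * (2 * R))"
proof -
  have "norm (w 1) \<le> R" using R N by simp
  then have R0: "R \<ge> 0" using norm_ge_zero[of "w 1"] by linarith
  have "\<bar>field_gap N u w\<bar> \<le> (\<Sum>l=1..N - 1. \<bar>u l (w 1) \<bullet> (w (l + 1) - w 1)\<bar>)"
    unfolding field_gap_def by (rule sum_abs)
  also have "\<dots> \<le> (\<Sum>l=1..N - 1. M * (2 * R))"
  proof (rule sum_mono)
    fix l assume l: "l \<in> {1..N - 1}"
    have "\<bar>u l (w 1) \<bullet> (w (l + 1) - w 1)\<bar> \<le> norm (u l (w 1)) * norm (w (l + 1) - w 1)"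
      by (rule Cauchy_Schwarz_ineq2)
    also have "\<dots> \<le> M * (2 * R)"
    proof (rule mult_mono[OF _ _ M(1) norm_ge_zero])
      show "norm (u l (w 1)) \<le> M" using M(2)[OF l tuples_D[OF w, of 1]] N by simp
      have "norm (w (l + 1)) \<le> R" using R[of "l + 1"] l by auto
      then show "norm (w (l + 1) - w 1) \<le> 2 * R"
        using \<open>norm (w 1) \<le> R\<close> norm_triangle_ineq4[of "w (l + 1)" "w 1"] by linarith
    qed
    finally show "\<bar>u l (w 1) \<bullet> (w (l + 1) - w 1)\<bar> \<le> M * (2 * R)" .
  qed
  also have "\<dots> \<le> real N * (M * (2 * R))"
    using M(1) R0 by (simp add: mult_right_mono mult_nonneg_nonneg)
  finally show ?thesis .
qed

lemma continuous_on_cyc_pow: "continuous_on UNIV ((cyc N ^^ i) :: (nat \<Rightarrow> 'a::topological_space) \<Rightarrow> _)"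
proof (induction i)
  case (Suc i)
  have "continuous_on UNIV (cyc N :: (nat \<Rightarrow> 'a) \<Rightarrow> _)"
  proof (rule continuous_on_coordinatewise_then_product)
    fix j show "continuous_on UNIV (\<lambda>x::nat \<Rightarrow> 'a. cyc N x j)"
      unfolding cyc_def restrict_apply
      by (cases "j \<in> {1..N}"; cases "j = N")
         (simp_all only: if_True if_False simp_thms continuous_on_product_coordinates continuous_on_const)
  qed
  then show ?case using Suc continuous_on_compose2[of UNIV "cyc N" UNIV "cyc N ^^ i"] by (simp add: comp_def)
qed (simp add: id_def)

text \<open>On the diagonal all rotations coincide, so sub-antisymmetry forces \<open>H \<le> 0\<close> there.\<close>

lemma zero_on_diagonal_of_bounds:
  assumes N: "N \<ge> 1" and anti: "sub_antisymmetric N \<Omega> H"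
    and gap_le: "\<And>w. w \<in> tuples N \<Omega> \<Longrightarrow> field_gap N u w \<le> H w"
  shows "zero_on_diagonal N \<Omega> H"
  unfolding zero_on_diagonal_def
proof
  fix x assume x: "x \<in> \<Omega>"
  have d: "diag N x \<in> tuples N \<Omega>" by (rule diag_in_tuples[OF x])
  have "field_gap N u (diag N x) = 0" using N unfolding field_gap_def by (intro sum.neutral) (auto simp: diag_def)
  then have "0 \<le> H (diag N x)" using gap_le[OF d] by simp
  moreover have "real N * H (diag N x) \<le> 0"
    using anti d N unfolding sub_antisymmetric_orbit_sum orbit_sum_def by (auto simp: cyc_diag of_nat_diff)
  ultimately show "H (diag N x) = 0" using N by (simp add: mult_le_0_iff)
qed

text \<open>
  Removing the mean over the orbit increases \<open>H\<close>, because orbit sums are nonpositive. The resulting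
  \<open>G\<close> dominates the gap functional, which bounds the Legendre transform from above; on the diagonal
  both vanish, and the supremum is attained there.
\<close>

lemma exists_continuous_antisymmetric:
  fixes \<Omega> :: "'a::euclidean_space set"
  assumes N: "N \<ge> 1" and \<Omega>: "open \<Omega>" "convex \<Omega>"
    and bd: "\<forall>l\<in>{1..N - 1}. bounded (u l ` \<Omega>)"
    and H: "sub_antisymmetric N \<Omega> H" "concave_in_first N \<Omega> H" "convex_in_others N \<Omega> H"
    and gap_le: "\<And>w. w \<in> tuples N \<Omega> \<Longrightarrow> field_gap N u w \<le> H w"
  shows "\<exists>G. continuous_on (tuples N \<Omega>) G \<and> antisymmetric N \<Omega> G
      \<and> (\<forall>x\<in>\<Omega>. legendre N \<Omega> G x (\<lambda>l. u l x) = ereal (\<Sum>l=1..N - 1. u l x \<bullet> x))"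
proof -
  obtain M where M: "M \<ge> 0" "\<And>l y. l \<in> {1..N - 1} \<Longrightarrow> y \<in> \<Omega> \<Longrightarrow> norm (u l y) \<le> M"
    using common_bound[OF bd] by blast
  have contH: "continuous_on (tuples N \<Omega>) H"
  proof (rule continuous_on_tuples[OF N \<Omega> H(2,3)], intro exI ballI impI)
    fix R w assume w: "w \<in> tuples N \<Omega>" and R: "\<forall>j\<in>{1..N}. norm (w j) \<le> R"
    let ?b = "real N * (M * (2 * R))"
    have gap: "\<bar>field_gap N u ((cyc N ^^ i) w)\<bar> \<le> ?b" for i
    proof (rule field_gap_bound[OF M N cyc_pow_in_tuples[OF w]])
      fix j assume "j \<in> {1..N}"
      then show "norm ((cyc N ^^ i) w j) \<le> R"
        using R N cyc_pow_nth[OF w, of j i] by (auto simp: Suc_leI)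
    qed
    have "\<bar>rotated_sum N (field_gap N u) w\<bar> \<le> (\<Sum>i=1..N - 1. ?b)"
      by (rule order_trans[OF sum_abs sum_mono[OF gap]])
    also have "\<dots> \<le> real N * ?b"
    proof -
      have "0 \<le> ?b" using gap[of 0] abs_ge_zero order_trans by blast
      then have "real (N - 1) * ?b \<le> real N * ?b" by (intro mult_right_mono) auto
      then show ?thesis by simp
    qed
    finally have rot: "\<bar>rotated_sum N (field_gap N u) w\<bar> \<le> real N * ?b" .
    have "orbit_sum N H w \<le> 0" using H(1) w by (simp add: sub_antisymmetric_orbit_sum)
    then have "H w \<le> - rotated_sum N (field_gap N u) w"
      using rotated_sum_mono[OF w, of "field_gap N u" H, OF gap_le] unfolding orbit_sum_split by linarith
    moreover have "field_gap N u w \<le> H w" by (rule gap_le[OF w])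
    ultimately show "\<bar>H w\<bar> \<le> ?b + real N * ?b" using rot gap[of 0] by auto
  qed
  define G where "G w = H w - orbit_sum N H w / real N" for w
  have "continuous_on (tuples N \<Omega>) (\<lambda>w. H ((cyc N ^^ i) w))" for i
    by (rule continuous_on_compose2[OF contH continuous_on_subset[OF continuous_on_cyc_pow]])
       (auto intro: cyc_pow_in_tuples)
  then have "continuous_on (tuples N \<Omega>) G"
    unfolding G_def orbit_sum_def divide_inverse by (intro continuous_intros contH)
  moreover have "antisymmetric N \<Omega> G"
    unfolding antisymmetric_def
  proof
    fix w assume w: "w \<in> tuples N \<Omega>"
    have "(\<Sum>i=0..N - 1. G ((cyc N ^^ i) w)) = (\<Sum>i=0..N - 1. H ((cyc N ^^ i) w) - orbit_sum N H w / real N)"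
      unfolding G_def by (simp add: orbit_sum_cyc_pow[OF N w])
    also have "\<dots> = 0" using N by (simp add: sum_subtractf orbit_sum_def of_nat_diff)
    finally show "(\<Sum>i=0..N - 1. G ((cyc N ^^ i) w)) = 0" .
  qed
  moreover have "legendre N \<Omega> G x (\<lambda>l. u l x) = ereal (\<Sum>l=1..N - 1. u l x \<bullet> x)" if x: "x \<in> \<Omega>" for x
    unfolding legendre_def
  proof (rule antisym)
    show "(SUP y\<in>tuples (N - 1) \<Omega>. ereal ((\<Sum>i=1..N - 1. u i x \<bullet> y i) - G (prepend N x y)))
        \<le> ereal (\<Sum>l=1..N - 1. u l x \<bullet> x)"
    proof (rule SUP_least)
      fix y assume y: "y \<in> tuples (N - 1) \<Omega>"
      let ?w = "prepend N x y"
      have w: "?w \<in> tuples N \<Omega>" by (rule prepend_in_tuples[OF x y])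
      have "orbit_sum N H ?w / real N \<le> 0"
        using H(1) w by (simp add: sub_antisymmetric_orbit_sum divide_nonpos_nonneg)
      then have "field_gap N u ?w \<le> G ?w" using gap_le[OF w] by (simp add: G_def)
      moreover have "field_gap N u ?w = (\<Sum>i=1..N - 1. u i x \<bullet> y i) - (\<Sum>l=1..N - 1. u l x \<bullet> x)"
        unfolding field_gap_def sum_subtractf[symmetric] using N
        by (intro sum.cong) (auto simp: prepend_def inner_diff_right)
      ultimately show "ereal ((\<Sum>i=1..N - 1. u i x \<bullet> y i) - G ?w) \<le> ereal (\<Sum>l=1..N - 1. u l x \<bullet> x)"
        by simp
    qed
    have "H (diag N x) = 0"
      using zero_on_diagonal_of_bounds[OF N H(1) gap_le] x by (simp add: zero_on_diagonal_def)
    then have "G (prepend N x (diag (N - 1) x)) = 0"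
      unfolding prepend_diag by (simp add: G_def orbit_sum_def cyc_diag)
    moreover have "(\<Sum>i=1..N - 1. u i x \<bullet> diag (N - 1) x i) = (\<Sum>l=1..N - 1. u l x \<bullet> x)"
      by (intro sum.cong) (auto simp: diag_def)
    ultimately show "ereal (\<Sum>l=1..N - 1. u l x \<bullet> x)
        \<le> (SUP y\<in>tuples (N - 1) \<Omega>. ereal ((\<Sum>i=1..N - 1. u i x \<bullet> y i) - G (prepend N x y)))"
      by (intro SUP_upper2[OF diag_in_tuples[OF x]]) simp
  qed
  ultimately show ?thesis by blast
qed

section \<open>Recovering jointly monotone fields from a Hamiltonian\<close>

lemma jointly_monotone_of_field_gap_le:
  assumes N: "N \<ge> 1" and anti: "sub_antisymmetric N \<Omega> H"
    and gap_le: "\<And>w. w \<in> tuples N \<Omega> \<Longrightarrow> field_gap N v w \<le> H w"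
  shows "jointly_monotone N \<Omega> v"
  unfolding jointly_monotone_iff_sub_antisymmetric[OF N] sub_antisymmetric_orbit_sum
proof
  fix w assume w: "w \<in> tuples N \<Omega>"
  have "orbit_sum N (field_gap N v) w \<le> orbit_sum N H w"
    unfolding orbit_sum_def by (intro sum_mono gap_le cyc_pow_in_tuples w)
  also have "\<dots> \<le> 0" using anti w by (simp add: sub_antisymmetric_orbit_sum)
  finally show "orbit_sum N (field_gap N v) w \<le> 0" .
qed

lemma common_convergent_subsequence:
  fixes f :: "'b \<Rightarrow> nat \<Rightarrow> 'a::heine_borel"
  assumes "finite I" "\<And>i. i \<in> I \<Longrightarrow> bounded (range (f i))"
  obtains r g where "strict_mono (r :: nat \<Rightarrow> nat)" "\<And>i. i \<in> I \<Longrightarrow> (\<lambda>n. f i (r n)) \<longlonglongrightarrow> g i"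
proof -
  have "\<exists>r::nat \<Rightarrow> nat. strict_mono r \<and> (\<forall>i\<in>I. \<exists>g. (\<lambda>n. f i (r n)) \<longlonglongrightarrow> g)"
    using assms
  proof (induction I)
    case empty
    show ?case by (intro exI[of _ id]) (simp add: strict_mono_def)
  next
    case (insert i I)
    then obtain r :: "nat \<Rightarrow> nat" where r: "strict_mono r" "\<forall>i\<in>I. \<exists>g. (\<lambda>n. f i (r n)) \<longlonglongrightarrow> g"
      by auto
    have "bounded (range (\<lambda>n. f i (r n)))"
      by (rule bounded_subset[OF insert.prems[of i]]) auto
    then obtain l s where s: "strict_mono (s :: nat \<Rightarrow> nat)" "((\<lambda>n. f i (r n)) \<circ> s) \<longlonglongrightarrow> l"
      using bounded_imp_convergent_subsequence by blast
    have "\<exists>g. (\<lambda>n. f j ((r \<circ> s) n)) \<longlonglongrightarrow> g" if j: "j \<in> insert i I" for j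
    proof (cases "j = i")
      case True
      then show ?thesis using s(2) by (auto simp: comp_def)
    next
      case False
      then obtain g where "(\<lambda>n. f j (r n)) \<longlonglongrightarrow> g" using r(2) j by auto
      from LIMSEQ_subseq_LIMSEQ[OF this s(1)] show ?thesis by (auto simp: comp_def)
    qed
    then show ?case using strict_mono_o[OF r(1) s(1)] by blast
  qed
  then show ?thesis using that by metis
qed

lemma AE_dense_sequence:
  fixes x :: "'a::euclidean_space"
  assumes ae: "AE y in lebesgue. y \<in> \<Omega> \<longrightarrow> P y" and \<Omega>: "open \<Omega>" and x: "x \<in> \<Omega>"
  obtains s where "\<And>n. s n \<in> \<Omega>" "\<And>n. P (s n)" "s \<longlonglongrightarrow> x"
proof -
  have "\<exists>y. y \<in> \<Omega> \<and> P y \<and> dist y x < 1 / Suc n" for n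
  proof (rule ccontr)
    assume no: "\<nexists>y. y \<in> \<Omega> \<and> P y \<and> dist y x < 1 / Suc n"
    obtain Z where Z: "negligible Z" "{y. \<not> (y \<in> \<Omega> \<longrightarrow> P y)} \<subseteq> Z"
      using ae unfolding eventually_ae_filter_negligible by blast
    have "\<Omega> \<inter> ball x (1 / Suc n) \<subseteq> Z" using no Z(2) by (auto simp: dist_commute)
    then have "negligible (\<Omega> \<inter> ball x (1 / Suc n))" using Z(1) negligible_subset by blast
    moreover have "x \<in> \<Omega> \<inter> ball x (1 / Suc n)" using x by simp
    ultimately show False using open_not_negligible[of "\<Omega> \<inter> ball x (1 / Suc n)"] \<Omega> by blast
  qed
  then obtain s where s: "\<And>n. s n \<in> \<Omega> \<and> P (s n) \<and> dist (s n) x < 1 / Suc n" by metis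
  have "s \<longlonglongrightarrow> x"
  proof (rule metric_LIMSEQ_I)
    fix e :: real assume "e > 0"
    then obtain k where k: "1 / Suc k < e" using nat_approx_posE by blast
    have "dist (s n) x < e" if "n \<ge> k" for n
    proof -
      have "dist (s n) x < 1 / Suc n" using s by blast
      also have "\<dots> \<le> 1 / Suc k" using that by (intro divide_left_mono) auto
      finally show ?thesis using k by simp
    qed
    then show "\<exists>no. \<forall>n\<ge>no. dist (s n) x < e" by blast
  qed
  with s show ?thesis using that by blast
qed

text \<open>
  Existence of a subgradient at an exceptional point \<open>x\<close> without separation of convex sets: as the fields
  are bounded, they have a common limit point along a sequence of good points tending to \<open>x\<close>, and the
  subgradient inequality survives because a concave function on an open set is continuous.
\<close>

lemma field_gap_le_limit:
  fixes \<Omega> :: "'a::euclidean_space set"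
  assumes N: "N \<ge> 1" and \<Omega>: "open \<Omega>" and H: "concave_in_first N \<Omega> H"
    and bd: "\<forall>l\<in>{1..N - 1}. bounded (u l ` \<Omega>)" and x: "x \<in> \<Omega>"
    and dense: "AE y in lebesgue. y \<in> \<Omega> \<longrightarrow> P y"
    and gap_le: "\<And>w. w \<in> tuples N \<Omega> \<Longrightarrow> P (w 1) \<Longrightarrow> field_gap N u w \<le> H w"
  shows "\<exists>g. \<forall>w\<in>tuples N \<Omega>. w 1 = x \<longrightarrow> (\<Sum>l=1..N - 1. g l \<bullet> (w (l + 1) - x)) \<le> H w"
proof -
  obtain s where s: "\<And>n. s n \<in> \<Omega>" "\<And>n. P (s n)" "s \<longlonglongrightarrow> x"
    using AE_dense_sequence[OF dense \<Omega> x] by blast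
  have "bounded (range (\<lambda>n. u l (s n)))" if "l \<in> {1..N - 1}" for l
  proof (rule bounded_subset)
    show "bounded (u l ` \<Omega>)" using bd that by blast
    show "range (\<lambda>n. u l (s n)) \<subseteq> u l ` \<Omega>" using s(1) by blast
  qed
  then obtain r g where r: "strict_mono (r :: nat \<Rightarrow> nat)"
    and g: "\<And>l. l \<in> {1..N - 1} \<Longrightarrow> (\<lambda>n. u l (s (r n))) \<longlonglongrightarrow> g l"
    using common_convergent_subsequence[of "{1..N - 1}" "\<lambda>l n. u l (s n)"] by auto
  have sr: "(\<lambda>n. s (r n)) \<longlonglongrightarrow> x" using LIMSEQ_subseq_LIMSEQ[OF s(3) r] by (simp add: comp_def)
  have "(\<Sum>l=1..N - 1. g l \<bullet> (w (l + 1) - x)) \<le> H w" if w: "w \<in> tuples N \<Omega>" "w 1 = x" for w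
  proof (rule LIMSEQ_le)
    let ?w = "\<lambda>n. w(1 := s (r n))"
    have "convex_on \<Omega> (\<lambda>c. - H (w(1 := c)))"
      using concave_on_first_coordinate[OF H N w(1)] by (simp add: concave_on_def)
    then have "continuous_on \<Omega> (\<lambda>c. - (- H (w(1 := c))))"
      by (intro continuous_on_minus convex_on_continuous[OF \<Omega>])
    then have "isCont (\<lambda>c. H (w(1 := c))) x"
      using \<Omega> x continuous_on_eq_continuous_at by auto
    from isCont_tendsto_compose[OF this sr] show "(\<lambda>n. H (?w n)) \<longlonglongrightarrow> H w"
      using w(2) by (simp add: fun_upd_idem)
    show "(\<lambda>n. \<Sum>l=1..N - 1. u l (s (r n)) \<bullet> (w (l + 1) - s (r n)))
        \<longlonglongrightarrow> (\<Sum>l=1..N - 1. g l \<bullet> (w (l + 1) - x))"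
      by (intro tendsto_intros g sr)
    have "(\<Sum>l=1..N - 1. u l (s (r n)) \<bullet> (w (l + 1) - s (r n))) \<le> H (?w n)" for n
    proof -
      have "?w n \<in> tuples N \<Omega>" using tuples_fun_upd[OF w(1)] N s(1) by auto
      moreover have "field_gap N u (?w n) = (\<Sum>l=1..N - 1. u l (s (r n)) \<bullet> (w (l + 1) - s (r n)))"
        unfolding field_gap_def by (intro sum.cong) auto
      ultimately show ?thesis using gap_le[of "?w n"] s(2) by simp
    qed
    then show "\<exists>no. \<forall>n\<ge>no. (\<Sum>l=1..N - 1. u l (s (r n)) \<bullet> (w (l + 1) - s (r n))) \<le> H (?w n)" by blast
  qed
  then show ?thesis by blast
qed

lemma exists_jointly_monotone_extension:
  fixes \<Omega> :: "'a::euclidean_space set"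
  assumes N: "N \<ge> 2" and \<Omega>: "open \<Omega>" "convex \<Omega>"
    and bd: "\<forall>l\<in>{1..N - 1}. bounded (u l ` \<Omega>)"
    and H: "sub_antisymmetric N \<Omega> H" "zero_on_diagonal N \<Omega> H" "concave_in_first N \<Omega> H"
      "convex_in_others N \<Omega> H"
    and ae: "AE x in lebesgue. x \<in> \<Omega> \<longrightarrow> diagonal_gradient_at N \<Omega> H u x"
  shows "\<exists>v. jointly_monotone N \<Omega> v
      \<and> (\<forall>x\<in>\<Omega>. diagonal_gradient_at N \<Omega> H u x \<longrightarrow> (\<forall>l\<in>{1..N - 1}. v l x = u l x))"
proof -
  let ?P = "diagonal_gradient_at N \<Omega> H u"
  have N1: "N \<ge> 1" using N by simp
  have gap_le: "field_gap N u w \<le> H w" if "w \<in> tuples N \<Omega>" "?P (w 1)" for w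
    by (rule diagonal_gradient_imp_field_gap_le[OF N \<Omega>(2) H(4,2) that])
  define v where "v l x = (if ?P x then u l x else
    (SOME g. \<forall>w\<in>tuples N \<Omega>. w 1 = x \<longrightarrow> (\<Sum>l=1..N - 1. g l \<bullet> (w (l + 1) - x)) \<le> H w) l)" for l x
  have "field_gap N v w \<le> H w" if w: "w \<in> tuples N \<Omega>" for w
  proof (cases "?P (w 1)")
    case True
    then show ?thesis using gap_le[OF w] by (simp add: field_gap_def v_def)
  next
    case False
    have "w 1 \<in> \<Omega>" using tuples_D[OF w] N by auto
    from someI_ex[OF field_gap_le_limit[OF N1 \<Omega>(1) H(3) bd this ae gap_le]]
    show ?thesis using w False by (simp add: field_gap_def v_def)
  qed
  from jointly_monotone_of_field_gap_le[OF N1 H(1) this] have "jointly_monotone N \<Omega> v" .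
  then show ?thesis by (auto simp: v_def)
qed

section \<open>The representation theorem\<close>

theorem theorem2:
  fixes N :: nat
    and \<Omega> :: "(real ^ 'd) set"
    and u :: "nat \<Rightarrow> real ^ 'd \<Rightarrow> real ^ 'd"
  assumes "N \<ge> 2"
    and "open \<Omega>" and "convex \<Omega>" and "\<Omega> \<noteq> {}"
    and "\<forall>l\<in>{1..N - 1}. bounded (u l ` \<Omega>)"
  shows
    "(jointly_monotone N \<Omega> u \<longrightarrow>
       (\<exists>H. sub_antisymmetric N \<Omega> H \<and> zero_on_diagonal N \<Omega> H
          \<and> concave_in_first N \<Omega> H \<and> convex_in_others N \<Omega> H
          \<and> (AE x in lebesgue. x \<in> \<Omega> \<longrightarrow> diagonal_gradient_at N \<Omega> H u x)
          \<and> (\<forall>x\<in>tuples N \<Omega>.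
               ereal (H x)
                 + concavification N \<Omega> (\<lambda>w. \<Sum>i=1..N - 1. H ((cyc N ^^ i) w)) x = 0))
     \<and> (\<exists>G. continuous_on (tuples N \<Omega>) G \<and> antisymmetric N \<Omega> G
          \<and> (\<forall>x\<in>\<Omega>. legendre N \<Omega> G x (\<lambda>l. u l x) = ereal (\<Sum>l=1..N - 1. u l x \<bullet> x))))
   \<and> (\<forall>H. sub_antisymmetric N \<Omega> H \<and> zero_on_diagonal N \<Omega> H
          \<and> concave_in_first N \<Omega> H \<and> convex_in_others N \<Omega> H \<longrightarrow>
        ((\<forall>x\<in>\<Omega>. diagonal_gradient_at N \<Omega> H u x) \<longrightarrow> jointly_monotone N \<Omega> u)
      \<and> ((AE x in lebesgue. x \<in> \<Omega> \<longrightarrow> diagonal_gradient_at N \<Omega> H u x) \<longrightarrow>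
           (\<exists>v. jointly_monotone N \<Omega> v
              \<and> (\<forall>x\<in>\<Omega>. diagonal_gradient_at N \<Omega> H u x \<longrightarrow> (\<forall>l\<in>{1..N - 1}. v l x = u l x)))))"
proof (intro conjI impI allI)
  have N1: "N \<ge> 1" using assms(1) by simp
  {
    assume mono: "jointly_monotone N \<Omega> u"
    have "sub_antisymmetric_convex N \<Omega> (field_gap N u)"
      using mono convex_in_others_field_gap[OF N1]
      by (simp add: sub_antisymmetric_convex_def jointly_monotone_iff_sub_antisymmetric[OF N1])
    then obtain H where H: "sub_antisymmetric_convex N \<Omega> H" "concave_in_first N \<Omega> H"
      and gap_le: "\<And>w. w \<in> tuples N \<Omega> \<Longrightarrow> field_gap N u w \<le> H w"
      and conc: "\<And>w. w \<in> tuples N \<Omega> \<Longrightarrow> concavification N \<Omega> (rotated_sum N H) w = ereal (- H w)"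
      using exists_antisymmetric_majorant[OF N1 assms(3)] by blast
    have anti: "sub_antisymmetric N \<Omega> H" and conv: "convex_in_others N \<Omega> H"
      using H(1) by (auto simp: sub_antisymmetric_convex_def)
    have zero: "zero_on_diagonal N \<Omega> H" by (rule zero_on_diagonal_of_bounds[OF N1 anti gap_le])
    have "AE x in lebesgue. x \<in> \<Omega> \<longrightarrow> diagonal_gradient_at N \<Omega> H u x"
      using jointly_monotone_AE_isCont[OF assms(1) mono assms(2,5)]
    proof eventually_elim
      case (elim x)
      then show ?case using diagonal_gradient_at_isCont[OF assms(1) anti zero gap_le] by blast
    qed
    moreover have "ereal (H w) + concavification N \<Omega> (rotated_sum N H) w = 0"
      if "w \<in> tuples N \<Omega>" for w
      using conc[OF that] by (simp add: zero_ereal_def)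
    ultimately show "\<exists>H. sub_antisymmetric N \<Omega> H \<and> zero_on_diagonal N \<Omega> H
          \<and> concave_in_first N \<Omega> H \<and> convex_in_others N \<Omega> H
          \<and> (AE x in lebesgue. x \<in> \<Omega> \<longrightarrow> diagonal_gradient_at N \<Omega> H u x)
          \<and> (\<forall>x\<in>tuples N \<Omega>. ereal (H x) + concavification N \<Omega> (rotated_sum N H) x = 0)"
      using anti zero H(2) conv by blast
    show "\<exists>G. continuous_on (tuples N \<Omega>) G \<and> antisymmetric N \<Omega> G
          \<and> (\<forall>x\<in>\<Omega>. legendre N \<Omega> G x (\<lambda>l. u l x) = ereal (\<Sum>l=1..N - 1. u l x \<bullet> x))"
      by (rule exists_continuous_antisymmetric[OF N1 assms(2,3,5) anti H(2) conv gap_le])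
  }
  fix H
  assume H: "sub_antisymmetric N \<Omega> H \<and> zero_on_diagonal N \<Omega> H
          \<and> concave_in_first N \<Omega> H \<and> convex_in_others N \<Omega> H"
  {
    assume grad: "\<forall>x\<in>\<Omega>. diagonal_gradient_at N \<Omega> H u x"
    have "field_gap N u w \<le> H w" if w: "w \<in> tuples N \<Omega>" for w
      using diagonal_gradient_imp_field_gap_le[OF assms(1,3) _ _ w] H grad tuples_D[OF w, of 1] N1 by auto
    then show "jointly_monotone N \<Omega> u"
      using jointly_monotone_of_field_gap_le[OF N1] H by blast
  }
  assume "AE x in lebesgue. x \<in> \<Omega> \<longrightarrow> diagonal_gradient_at N \<Omega> H u x"
  then show "\<exists>v. jointly_monotone N \<Omega> v
      \<and> (\<forall>x\<in>\<Omega>. diagonal_gradient_at N \<Omega> H u x \<longrightarrow> (\<forall>l\<in>{1..N - 1}. v l x = u l x))"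
    using exists_jointly_monotone_extension[OF assms(1-3,5)] H by blast
qed

end
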